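(* Let $(X,\xi)$ be a $3$-dimensional complex contact manifold. If $M$ is a smooth real surface and $F:M\to X$ is a smooth Legendrian immersion, then $F(M)$ is an immersed complex curve in $X$. Furthermore, $M$ admits the structure of a Riemann surface such that $F:M\to X$ is holomorphic.
   Context: A complex contact manifold $(X,\xi)$ of complex dimension $3$ is a complex $3$-manifold $X$ with a holomorphic hyperplane subbundle $\xi\subset TX$ (complex corank $1$) which is locally, near every point, the kernel of a holomorphic contact form, i.e. a holomorphic $1$-form $\alpha$ with $\alpha\wedge d\alpha\ne 0$ at every point. A smooth map $F:M\to X$ from a smooth manifold is Legendrian if $dF_p(T_pM)\subset\xi_{F(p)}$ for every $p\in M$ (equivalently $F^*\alpha=0$ for every local contact form $\alpha$ defining $\xi$). *)

theory Defs
  imports "HOL-Analysis.Analysis"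
begin

section \<open>Smooth and holomorphic maps between open sets\<close>

text \<open>All of the following notions are used for open sets only, so that the derivative
  at a point of the set is unique.\<close>

primrec Ck_on :: "nat \<Rightarrow> ('a::real_normed_vector \<Rightarrow> 'b::real_normed_vector) \<Rightarrow> 'a set \<Rightarrow> bool" where
  "Ck_on 0 f S \<longleftrightarrow> continuous_on S f"
| "Ck_on (Suc k) f S \<longleftrightarrow> (\<forall>x\<in>S. f differentiable (at x)) \<and>
     (\<forall>v. Ck_on k (\<lambda>x. frechet_derivative f (at x) v) S)"

definition smooth_on :: "'a::real_normed_vector set \<Rightarrow> ('a \<Rightarrow> 'b::real_normed_vector) \<Rightarrow> bool" where
  "smooth_on S f \<longleftrightarrow> (\<forall>k. Ck_on k f S)"

text \<open>Holomorphy in several variables: the real Frechet derivative exists and is complex linear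
  at every point.\<close>

definition holo_on :: "(complex^'n) set \<Rightarrow> (complex^'n \<Rightarrow> complex^'m) \<Rightarrow> bool" where
  "holo_on S f \<longleftrightarrow> (\<forall>z\<in>S. \<exists>D. (f has_derivative D) (at z) \<and> (\<forall>a v. D (a *s v) = a *s D v))"


section \<open>Manifolds\<close>

text \<open>A chart is a pair of a domain and a coordinate map; the values of the coordinate map
  outside the domain are irrelevant. An atlas is not required to be maximal.\<close>

type_synonym ('x, 'v) chart = "'x set \<times> ('x \<Rightarrow> 'v)"

definition chart_on :: "'x topology \<Rightarrow> ('x, 'v::real_normed_vector) chart \<Rightarrow> bool" where
  "chart_on X c \<longleftrightarrow> openin X (fst c) \<and> open (snd c ` fst c) \<and>
     homeomorphic_map (subtopology X (fst c)) (top_of_set (snd c ` fst c)) (snd c)"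

abbreviation chart_inv :: "('x, 'v) chart \<Rightarrow> 'v \<Rightarrow> 'x" where
  "chart_inv c \<equiv> inv_into (fst c) (snd c)"

definition local_rep :: "('x, 'v) chart \<Rightarrow> ('x \<Rightarrow> 'y) \<Rightarrow> ('y, 'w) chart \<Rightarrow> 'v \<Rightarrow> 'w" where
  "local_rep c F d = (\<lambda>z. snd d (F (chart_inv c z)))"

definition local_dom :: "('x, 'v) chart \<Rightarrow> ('x \<Rightarrow> 'y) \<Rightarrow> ('y, 'w) chart \<Rightarrow> 'v set" where
  "local_dom c F d = snd c ` {p \<in> fst c. F p \<in> fst d}"

abbreviation coord_change :: "('x, 'v) chart \<Rightarrow> ('x, 'w) chart \<Rightarrow> 'v \<Rightarrow> 'w" where
  "coord_change c d \<equiv> local_rep c (\<lambda>p. p) d"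

abbreviation coord_dom :: "('x, 'v) chart \<Rightarrow> ('x, 'w) chart \<Rightarrow> 'v set" where
  "coord_dom c d \<equiv> local_dom c (\<lambda>p. p) d"

definition topological_atlas :: "'x topology \<Rightarrow> ('x, 'v::real_normed_vector) chart set \<Rightarrow> bool" where
  "topological_atlas X A \<longleftrightarrow> Hausdorff_space X \<and> second_countable X \<and>
     (\<forall>c\<in>A. chart_on X c) \<and> (\<Union>c\<in>A. fst c) = topspace X"

definition smooth_manifold :: "'x topology \<Rightarrow> ('x, real^'n) chart set \<Rightarrow> bool" where
  "smooth_manifold X A \<longleftrightarrow> topological_atlas X A \<and>
     (\<forall>c\<in>A. \<forall>d\<in>A. smooth_on (coord_dom c d) (coord_change c d))"

definition complex_manifold :: "'x topology \<Rightarrow> ('x, complex^'n) chart set \<Rightarrow> bool" where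
  "complex_manifold X A \<longleftrightarrow> topological_atlas X A \<and>
     (\<forall>c\<in>A. \<forall>d\<in>A. holo_on (coord_dom c d) (coord_change c d))"

text \<open>The codomain may be a complex manifold, regarded as a real smooth manifold.\<close>

definition smooth_map ::
  "'x topology \<Rightarrow> ('x, 'v::real_normed_vector) chart set \<Rightarrow>
   'y topology \<Rightarrow> ('y, 'w::real_normed_vector) chart set \<Rightarrow> ('x \<Rightarrow> 'y) \<Rightarrow> bool" where
  "smooth_map X A Y B F \<longleftrightarrow> continuous_map X Y F \<and>
     (\<forall>c\<in>A. \<forall>d\<in>B. smooth_on (local_dom c F d) (local_rep c F d))"

definition holomorphic_map ::
  "'x topology \<Rightarrow> ('x, complex^'n) chart set \<Rightarrow>
   'y topology \<Rightarrow> ('y, complex^'m) chart set \<Rightarrow> ('x \<Rightarrow> 'y) \<Rightarrow> bool" where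
  "holomorphic_map X A Y B F \<longleftrightarrow> continuous_map X Y F \<and>
     (\<forall>c\<in>A. \<forall>d\<in>B. holo_on (local_dom c F d) (local_rep c F d))"


section \<open>Tangent vectors\<close>

definition charts_at :: "('x, 'v) chart set \<Rightarrow> 'x \<Rightarrow> ('x, 'v) chart set" where
  "charts_at A p = {c \<in> A. p \<in> fst c}"

text \<open>A tangent vector at \<open>p\<close> is a family of coordinate vectors, one for each chart of the atlas
  around \<open>p\<close>, which transforms by the derivatives of the coordinate changes. The family is zero
  on all other pairs, so that the vector space operations on the tangent space are the
  pointwise ones.\<close>

type_synonym ('x, 'v) tvec = "('x, 'v) chart \<Rightarrow> 'v"

definition tangent_space ::
  "('x, 'v::real_normed_vector) chart set \<Rightarrow> 'x \<Rightarrow> ('x, 'v) tvec set" where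
  "tangent_space A p = {v. (\<forall>c. c \<notin> charts_at A p \<longrightarrow> v c = 0) \<and>
     (\<forall>c\<in>charts_at A p. \<forall>d\<in>charts_at A p.
        v d = frechet_derivative (coord_change c d) (at (snd c p)) (v c))}"

text \<open>The tangent vector at \<open>p\<close> whose coordinate vector in the chart \<open>c\<close> is \<open>u\<close>.\<close>

definition coord_tvec ::
  "('x, 'v::real_normed_vector) chart set \<Rightarrow> ('x, 'v) chart \<Rightarrow> 'x \<Rightarrow> 'v \<Rightarrow> ('x, 'v) tvec" where
  "coord_tvec A c p u = (\<lambda>d. if d \<in> charts_at A p
     then frechet_derivative (coord_change c d) (at (snd c p)) u else 0)"

text \<open>The differential; by the chain rule the choice of the chart around \<open>p\<close> does not matter.\<close>

definition differential ::
  "('x, 'v::real_normed_vector) chart set \<Rightarrow> ('y, 'w::real_normed_vector) chart set \<Rightarrow>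
   ('x \<Rightarrow> 'y) \<Rightarrow> 'x \<Rightarrow> ('x, 'v) tvec \<Rightarrow> ('y, 'w) tvec" where
  "differential A B F p v = (let c = (SOME c. c \<in> charts_at A p) in
     (\<lambda>d. if d \<in> charts_at B (F p)
       then frechet_derivative (local_rep c F d) (at (snd c p)) (v c) else 0))"

definition immersion ::
  "'x topology \<Rightarrow> ('x, 'v::real_normed_vector) chart set \<Rightarrow>
   'y topology \<Rightarrow> ('y, 'w::real_normed_vector) chart set \<Rightarrow> ('x \<Rightarrow> 'y) \<Rightarrow> bool" where
  "immersion X A Y B F \<longleftrightarrow>
     (\<forall>p\<in>topspace X. inj_on (differential A B F p) (tangent_space A p))"


section \<open>Complex contact manifolds\<close>

definition holomorphic_vector_field ::
  "('x, complex^'n) chart set \<Rightarrow> 'x set \<Rightarrow> ('x \<Rightarrow> ('x, complex^'n) tvec) \<Rightarrow> bool" where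
  "holomorphic_vector_field A W s \<longleftrightarrow> (\<forall>q\<in>W. s q \<in> tangent_space A q) \<and>
     (\<forall>c\<in>A. holo_on (snd c ` (W \<inter> fst c)) (\<lambda>z. s (chart_inv c z) c))"

definition holomorphic_subbundle ::
  "'x topology \<Rightarrow> ('x, complex^'n) chart set \<Rightarrow> nat \<Rightarrow> ('x \<Rightarrow> ('x, complex^'n) tvec set) \<Rightarrow> bool" where
  "holomorphic_subbundle X A r \<xi> \<longleftrightarrow> (\<forall>p\<in>topspace X. \<exists>W s. openin X W \<and> p \<in> W \<and>
     (\<forall>i<r. holomorphic_vector_field A W (s i)) \<and>
     (\<forall>q\<in>W.
        (\<forall>a::nat \<Rightarrow> complex. (\<forall>c. (\<Sum>i<r. a i *s s i q c) = 0) \<longrightarrow> (\<forall>i<r. a i = 0)) \<and>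
        \<xi> q = {(\<lambda>c. \<Sum>i<r. a i *s s i q c) | a::nat \<Rightarrow> complex. True}))"

definition holomorphic_hyperplane_subbundle ::
  "'x topology \<Rightarrow> ('x, complex^'n) chart set \<Rightarrow> ('x \<Rightarrow> ('x, complex^'n) tvec set) \<Rightarrow> bool" where
  "holomorphic_hyperplane_subbundle X A \<xi> \<longleftrightarrow> holomorphic_subbundle X A (CARD('n) - 1) \<xi>"

text \<open>The expression of a 1-form in a chart, as a function of the base point and of a coordinate
  vector.\<close>

definition form_rep ::
  "('x, complex^'n) chart set \<Rightarrow> ('x \<Rightarrow> ('x, complex^'n) tvec \<Rightarrow> complex) \<Rightarrow>
   ('x, complex^'n) chart \<Rightarrow> complex^'n \<Rightarrow> complex^'n \<Rightarrow> complex" where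
  "form_rep A \<alpha> c = (\<lambda>z u. \<alpha> (chart_inv c z) (coord_tvec A c (chart_inv c z) u))"

text \<open>Holomorphy of \<open>\<alpha>\<close> means that the coefficients \<open>a\<^sub>j\<close> in \<open>\<alpha> = \<Sum>\<^sub>j a\<^sub>j dz\<^sub>j\<close> are holomorphic;
  they are the values of \<open>\<alpha>\<close> on the coordinate vector fields.\<close>

definition holomorphic_one_form ::
  "('x, complex^'n) chart set \<Rightarrow> 'x set \<Rightarrow> ('x \<Rightarrow> ('x, complex^'n) tvec \<Rightarrow> complex) \<Rightarrow> bool" where
  "holomorphic_one_form A W \<alpha> \<longleftrightarrow>
     (\<forall>q\<in>W. \<forall>v\<in>tangent_space A q. \<forall>w\<in>tangent_space A q. \<forall>a b.
        \<alpha> q (\<lambda>c. a *s v c + b *s w c) = a * \<alpha> q v + b * \<alpha> q w) \<and>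
     (\<forall>c\<in>A. holo_on (snd c ` (W \<inter> fst c)) (\<lambda>z. \<chi> j. form_rep A \<alpha> c z (axis j 1)))"

text \<open>\<open>d\<omega>(u, v) = u(\<omega>(v)) - v(\<omega>(u))\<close> for constant vector fields \<open>u\<close> and \<open>v\<close>, whose Lie bracket
  vanishes.\<close>

definition ext_deriv ::
  "(complex^'n \<Rightarrow> complex^'n \<Rightarrow> complex) \<Rightarrow> complex^'n \<Rightarrow> complex^'n \<Rightarrow> complex^'n \<Rightarrow> complex" where
  "ext_deriv \<omega> z u v =
     frechet_derivative (\<lambda>y. \<omega> y v) (at z) u - frechet_derivative (\<lambda>y. \<omega> y u) (at z) v"

definition wedge_1_2 ::
  "('v \<Rightarrow> complex) \<Rightarrow> ('v \<Rightarrow> 'v \<Rightarrow> complex) \<Rightarrow> 'v \<Rightarrow> 'v \<Rightarrow> 'v \<Rightarrow> complex" where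
  "wedge_1_2 \<alpha> \<beta> u v w = \<alpha> u * \<beta> v w + \<alpha> v * \<beta> w u + \<alpha> w * \<beta> u v"

definition holomorphic_contact_form ::
  "('x, complex^3) chart set \<Rightarrow> 'x set \<Rightarrow> ('x \<Rightarrow> ('x, complex^3) tvec \<Rightarrow> complex) \<Rightarrow> bool" where
  "holomorphic_contact_form A W \<alpha> \<longleftrightarrow> holomorphic_one_form A W \<alpha> \<and>
     (\<forall>c\<in>A. \<forall>z\<in>snd c ` (W \<inter> fst c). \<exists>u v w.
        wedge_1_2 (form_rep A \<alpha> c z) (ext_deriv (form_rep A \<alpha> c) z) u v w \<noteq> 0)"

definition complex_contact_manifold ::
  "'x topology \<Rightarrow> ('x, complex^3) chart set \<Rightarrow> ('x \<Rightarrow> ('x, complex^3) tvec set) \<Rightarrow> bool" where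
  "complex_contact_manifold X A \<xi> \<longleftrightarrow> complex_manifold X A \<and>
     holomorphic_hyperplane_subbundle X A \<xi> \<and>
     (\<forall>p\<in>topspace X. \<exists>W \<alpha>. openin X W \<and> p \<in> W \<and> holomorphic_contact_form A W \<alpha> \<and>
        (\<forall>q\<in>W. \<xi> q = {v \<in> tangent_space A q. \<alpha> q v = 0}))"

definition legendrian ::
  "'m topology \<Rightarrow> ('m, 'v::real_normed_vector) chart set \<Rightarrow> ('x, complex^3) chart set \<Rightarrow>
   ('x \<Rightarrow> ('x, complex^3) tvec set) \<Rightarrow> ('m \<Rightarrow> 'x) \<Rightarrow> bool" where
  "legendrian M B A \<xi> F \<longleftrightarrow>
     (\<forall>p\<in>topspace M. differential B A F p ` tangent_space B p \<subseteq> \<xi> (F p))"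


section \<open>Complex curves\<close>

text \<open>Riemann surfaces are not required to be connected.\<close>

definition riemann_surface :: "'r topology \<Rightarrow> ('r, complex^1) chart set \<Rightarrow> bool" where
  "riemann_surface R C \<longleftrightarrow> complex_manifold R C"

text \<open>The complex structure induces the given smooth structure.\<close>

definition riemann_surface_structure ::
  "'m topology \<Rightarrow> ('m, real^2) chart set \<Rightarrow> ('m, complex^1) chart set \<Rightarrow> bool" where
  "riemann_surface_structure M B C \<longleftrightarrow> riemann_surface M C \<and>
     (\<forall>b\<in>B. \<forall>c\<in>C. smooth_on (coord_dom b c) (coord_change b c) \<and>
        smooth_on (coord_dom c b) (coord_change c b))"

text \<open>An immersed complex curve is the image of a holomorphic immersion of a Riemann surface.
  A definition cannot quantify over the type of points of the Riemann surface, hence the type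
  argument.\<close>

definition immersed_complex_curve ::
  "'r itself \<Rightarrow> 'x topology \<Rightarrow> ('x, complex^'n) chart set \<Rightarrow> 'x set \<Rightarrow> bool" where
  "immersed_complex_curve _ X A S \<longleftrightarrow>
     (\<exists>(R :: 'r topology) C G. riemann_surface R C \<and> holomorphic_map R C X A G \<and>
        immersion R C X A G \<and> G ` topspace R = S)"

end

theory Submission
  imports Defs
begin

text \<open>Since \<open>F\<^sup>*\<alpha> = 0\<close> implies \<open>F\<^sup>*d\<alpha> = 0\<close> and \<open>d\<alpha>\<close> is a complex symplectic form on the complex planes
  of \<open>\<xi>\<close>, any two vectors of \<open>dF(T\<^sub>pM)\<close> are complex linearly dependent, so this real plane is a
  complex line. Some coordinate of the target restricts to an isomorphism of this line with
  \<open>\<complex>\<close>; hence the corresponding component of \<open>F\<close> is a local diffeomorphism from \<open>M\<close> to \<open>\<complex>\<close>.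
  Taking these components as charts of \<open>M\<close>, the derivative of \<open>F\<close> becomes complex linear, and so
  do those of the coordinate changes, being components of \<open>F\<close> themselves. No integrability
  theorem for almost complex structures is involved.\<close>

section \<open>Smooth maps and their inverses\<close>

text \<open>\<open>M\<close> comes with charts in \<open>real^2\<close>, while a component of
  \<open>F\<close> takes values in \<open>complex^1\<close>; the two spaces meet only as real vector
  spaces of equal dimension. The new atlas has to induce the given smooth structure, so the inverses
  of the component maps must be smooth to every order; the calculus of \<open>Ck_on\<close> serves
  this purpose. On the complex side, holomorphy is pointwise complex linearity of first derivatives,
  so it can be read off from the image of \<open>dF\<close> at each point. The coefficients of
  \<alpha> are differentiated once; the symmetric second derivative in the argument is that of the
  real smooth map \<open>F\<close>. The curve \<open>F(M)\<close> is parametrized by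
  \<open>M\<close> itself: points and topology stay, only the atlas is replaced.\<close>

lemma Ck_on_cong:
  assumes "open S" "\<And>x. x \<in> S \<Longrightarrow> f x = g x" "Ck_on k f S"
  shows "Ck_on k g S"
  using assms(2,3)
proof (induction k arbitrary: f g)
  case 0
  then show ?case using continuous_on_eq by fastforce
next
  case (Suc k)
  have d: "g differentiable (at x)"
    and eq: "frechet_derivative f (at x) = frechet_derivative g (at x)" if "x \<in> S" for x
  proof -
    have "f differentiable (at x)" using Suc.prems that by simp
    then show "g differentiable (at x)"
      using has_derivative_transform_within_open[OF _ assms(1) that] Suc.prems(1)
      unfolding differentiable_def by blast
    show "frechet_derivative f (at x) = frechet_derivative g (at x)"
      using frechet_derivative_transform_within_open[OF \<open>f differentiable (at x)\<close> assms(1) that] Suc.prems(1)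
      by blast
  qed
  have "Ck_on k (\<lambda>x. frechet_derivative g (at x) v) S" for v
  proof (rule Suc.IH[of "\<lambda>x. frechet_derivative f (at x) v"])
    show "frechet_derivative f (at x) v = frechet_derivative g (at x) v" if "x \<in> S" for x
      by (simp only: eq[OF that])
    show "Ck_on k (\<lambda>x. frechet_derivative f (at x) v) S" using Suc.prems by simp
  qed
  then show ?case using d by simp
qed

text \<open>The recursion of \<open>Ck_on\<close> mentions \<open>frechet_derivative\<close>, which
  is a choice; by uniqueness of derivatives on an open set, a formula \<open>D\<close> obtained from
  the differentiation rules may replace it.\<close>

lemma Ck_on_SucI:
  assumes "open S" "\<And>x. x \<in> S \<Longrightarrow> (f has_derivative D x) (at x)"
    "\<And>v. Ck_on k (\<lambda>x. D x v) S"
  shows "Ck_on (Suc k) f S"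
proof -
  have "frechet_derivative f (at x) = D x" if "x \<in> S" for x
    using assms(2)[OF that] frechet_derivative_at by metis
  then have "Ck_on k (\<lambda>x. frechet_derivative f (at x) v) S" for v
    by (intro Ck_on_cong[OF assms(1) _ assms(3)[of v]]) auto
  then show ?thesis using assms(2) by (auto simp: differentiable_def)
qed

lemma Ck_on_has_derivative:
  assumes "Ck_on (Suc k) f S" "x \<in> S"
  shows "(f has_derivative frechet_derivative f (at x)) (at x)"
  using assms frechet_derivative_works by auto

lemma Ck_on_SucD: "Ck_on (Suc k) f S \<Longrightarrow> Ck_on k f S"
proof (induction k arbitrary: f)
  case 0
  then show ?case
    by (auto intro!: continuous_at_imp_continuous_on differentiable_imp_continuous_within)
qed auto

lemma Ck_on_subset: "Ck_on k f S \<Longrightarrow> T \<subseteq> S \<Longrightarrow> Ck_on k f T"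
  by (induction k arbitrary: f) (auto intro: continuous_on_subset)

lemma Ck_on_const: "Ck_on k (\<lambda>x. c) S"
  by (induction k arbitrary: c) auto

lemma Ck_on_bounded_linear:
  assumes "open S" "bounded_linear L" "Ck_on k f S"
  shows "Ck_on k (\<lambda>x. L (f x)) S"
  using assms(3)
proof (induction k arbitrary: f)
  case 0
  then show ?case
    using bounded_linear.continuous_on[OF assms(2)] by simp
next
  case (Suc k)
  show ?case
  proof (rule Ck_on_SucI[OF assms(1)])
    show "((\<lambda>x. L (f x)) has_derivative (\<lambda>v. L (frechet_derivative f (at x) v))) (at x)" if "x \<in> S" for x
      using bounded_linear.has_derivative[OF assms(2) Ck_on_has_derivative[OF Suc.prems that]] .
    show "Ck_on k (\<lambda>x. L (frechet_derivative f (at x) v)) S" for v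
      using Suc by simp
  qed
qed

lemma Ck_on_add:
  assumes "open S" "Ck_on k f S" "Ck_on k g S"
  shows "Ck_on k (\<lambda>x. f x + g x) S"
  using assms(2,3)
proof (induction k arbitrary: f g)
  case 0
  then show ?case by (simp add: continuous_on_add)
next
  case (Suc k)
  show ?case
  proof (rule Ck_on_SucI[OF assms(1)])
    show "((\<lambda>x. f x + g x) has_derivative
        (\<lambda>v. frechet_derivative f (at x) v + frechet_derivative g (at x) v)) (at x)" if "x \<in> S" for x
      using has_derivative_add Ck_on_has_derivative that Suc.prems by blast
    show "Ck_on k (\<lambda>x. frechet_derivative f (at x) v + frechet_derivative g (at x) v) S" for v
      using Suc by simp
  qed
qed

lemma Ck_on_bilinear:
  assumes "open S" "bounded_bilinear B" "Ck_on k f S" "Ck_on k g S"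
  shows "Ck_on k (\<lambda>x. B (f x) (g x)) S"
  using assms(3,4)
proof (induction k arbitrary: f g)
  case 0
  then show ?case using bounded_bilinear.continuous_on[OF assms(2)] by simp
next
  case (Suc k)
  show ?case
  proof (rule Ck_on_SucI[OF assms(1)])
    show "((\<lambda>x. B (f x) (g x)) has_derivative
        (\<lambda>v. B (f x) (frechet_derivative g (at x) v) + B (frechet_derivative f (at x) v) (g x))) (at x)"
      if "x \<in> S" for x
      using bounded_bilinear.FDERIV[OF assms(2) Suc.prems[THEN Ck_on_has_derivative, OF that]] .
    show "Ck_on k (\<lambda>x. B (f x) (frechet_derivative g (at x) v) + B (frechet_derivative f (at x) v) (g x)) S" for v
      \<comment> \<open>The product rule leaves one factor undifferentiated, so \<open>f\<close> and
        \<open>g\<close> are also needed at the lower order \<open>k\<close>.\<close>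
      using Suc.prems Suc.prems[THEN Ck_on_SucD] by (intro Ck_on_add[OF assms(1)] Suc.IH) simp_all
  qed
qed

lemma Ck_on_mult:
  fixes f g :: "'a::real_normed_vector \<Rightarrow> 'b::real_normed_algebra"
  assumes "open S" "Ck_on k f S" "Ck_on k g S"
  shows "Ck_on k (\<lambda>x. f x * g x) S"
  using Ck_on_bilinear[OF assms(1) bounded_bilinear_mult assms(2,3)] .

lemma Ck_on_sum:
  assumes "open S" "\<And>i. i \<in> I \<Longrightarrow> Ck_on k (f i) S"
  shows "Ck_on k (\<lambda>x. \<Sum>i\<in>I. f i x) S"
  using assms(2)
  by (induction I rule: infinite_finite_induct) (auto intro: Ck_on_const Ck_on_add[OF assms(1)])

lemma Ck_on_prod:
  fixes f :: "'i \<Rightarrow> 'a::real_normed_vector \<Rightarrow> 'b::{real_normed_algebra,comm_ring_1}"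
  assumes "open S" "\<And>i. i \<in> I \<Longrightarrow> Ck_on k (f i) S"
  shows "Ck_on k (\<lambda>x. \<Prod>i\<in>I. f i x) S"
  using assms(2)
  by (induction I rule: infinite_finite_induct) (auto intro: Ck_on_const Ck_on_mult[OF assms(1)])

lemma Ck_on_inverse:
  fixes f :: "'a::real_normed_vector \<Rightarrow> 'b::real_normed_field"
  assumes "open S" "\<And>x. x \<in> S \<Longrightarrow> f x \<noteq> 0" "Ck_on k f S"
  shows "Ck_on k (\<lambda>x. inverse (f x)) S"
  using assms(3)
proof (induction k)
  case 0
  then show ?case using assms(2) by (simp add: continuous_on_inverse)
next
  case (Suc k)
  show ?case
  proof (rule Ck_on_SucI[OF assms(1)])
    show "((\<lambda>x. inverse (f x)) has_derivative
        (\<lambda>v. - (inverse (f x) * frechet_derivative f (at x) v * inverse (f x)))) (at x)"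
      if "x \<in> S" for x
      using Deriv.has_derivative_inverse[OF assms(2) Ck_on_has_derivative[OF Suc.prems that]] that by blast
    \<comment> \<open>The derivative of \<open>1/f\<close> contains \<open>1/f\<close> again, and
      the induction hypothesis supplies it at order \<open>k\<close>.\<close>
    have "Ck_on k (\<lambda>x. inverse (f x)) S" using Suc Ck_on_SucD by blast
    moreover have "Ck_on k (\<lambda>x. frechet_derivative f (at x) v) S" for v using Suc.prems by simp
    ultimately show "Ck_on k (\<lambda>x. - (inverse (f x) * frechet_derivative f (at x) v * inverse (f x))) S" for v
      by (intro Ck_on_bounded_linear[OF assms(1) bounded_linear_minus[OF bounded_linear_ident]] Ck_on_mult[OF assms(1)])
  qed
qed

text \<open>\<open>Ck_on\<close> controls the derivative of \<open>g\<close> in fixed directions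
  only, whereas the chain rule applies it to a vector that moves with \<open>x\<close>. Expanding
  that vector over \<open>Basis\<close> separates the two dependencies; hence the Euclidean middle
  space.\<close>

lemma Ck_on_compose:
  fixes f :: "'a::real_normed_vector \<Rightarrow> 'b::euclidean_space"
  assumes "open S" "open T" "f ` S \<subseteq> T" "Ck_on k f S" "Ck_on k g T"
  shows "Ck_on k (\<lambda>x. g (f x)) S"
  using assms(4,5)
proof (induction k arbitrary: g)
  case 0
  then show ?case using assms(3) by (auto intro: continuous_on_compose2)
next
  case (Suc k)
  let ?D = "\<lambda>x v. \<Sum>b\<in>Basis. (frechet_derivative f (at x) v \<bullet> b) *\<^sub>R frechet_derivative g (at (f x)) b"
  show ?case
  proof (rule Ck_on_SucI[OF assms(1)])
    fix x assume x: "x \<in> S"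
    then have fx: "f x \<in> T" using assms(3) by auto
    note dg = Ck_on_has_derivative[OF Suc.prems(2) fx]
    have "linear (frechet_derivative g (at (f x)))"
      using dg has_derivative_linear by blast
    then have "frechet_derivative g (at (f x)) w
        = (\<Sum>b\<in>Basis. (w \<bullet> b) *\<^sub>R frechet_derivative g (at (f x)) b)" for w
      by (subst (1) euclidean_representation[of w, symmetric]) (simp only: linear_sum linear_cmul)
    then have "?D x v = frechet_derivative g (at (f x)) (frechet_derivative f (at x) v)" for v
      by metis
    then show "((\<lambda>x. g (f x)) has_derivative ?D x) (at x)"
      using has_derivative_compose[OF Ck_on_has_derivative[OF Suc.prems(1) x] dg] by simp
  next
    fix v
    have "Ck_on k (\<lambda>x. frechet_derivative f (at x) v) S" "Ck_on k f S"
      using Suc.prems(1) Ck_on_SucD by auto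
    then show "Ck_on k (\<lambda>x. ?D x v) S"
      using Suc.prems(2)
      by (intro Ck_on_sum assms(1) Ck_on_bilinear[OF assms(1) bounded_bilinear_scaleR]
          Ck_on_bounded_linear[OF assms(1) bounded_linear_inner_left] Suc.IH) auto
  qed
qed

lemma Ck_on_vec_lambda:
  fixes f :: "'a::real_normed_vector \<Rightarrow> 'b::real_normed_vector^'n"
  assumes "open S" "\<And>i. Ck_on k (\<lambda>x. f x $ i) S"
  shows "Ck_on k f S"
proof -
  have bl: "bounded_linear (\<lambda>y. axis i y :: 'b^'n)" for i
  proof (intro bounded_linear_intro[where K=1])
    fix y :: 'b
    have "(norm ((axis i y :: 'b^'n) $ j))\<^sup>2 = (if j = i then (norm y)\<^sup>2 else 0)" for j
      by (simp add: axis_def)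
    then show "norm (axis i y :: 'b^'n) \<le> norm y * 1"
      by (simp add: norm_vec_def L2_set_def)
  qed (auto simp: axis_def vec_eq_iff)
  have eq: "(\<Sum>i\<in>UNIV. axis i (f x $ i)) = f x" for x
    by (simp add: vec_eq_iff axis_def if_distrib sum.delta' cong: if_cong)
  have "Ck_on k (\<lambda>x. \<Sum>i\<in>UNIV. axis i (f x $ i)) S"
    by (intro Ck_on_sum assms(1) Ck_on_bounded_linear[OF assms(1) bl] assms(2))
  then show ?thesis by (simp only: eq)
qed

lemma smooth_on_has_derivative:
  assumes "smooth_on S f" "x \<in> S"
  shows "(f has_derivative frechet_derivative f (at x)) (at x)"
  using assms Ck_on_has_derivative unfolding smooth_on_def by blast

lemma smooth_on_bounded_linear:
  "open S \<Longrightarrow> bounded_linear L \<Longrightarrow> smooth_on S f \<Longrightarrow> smooth_on S (\<lambda>x. L (f x))"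
  by (simp add: smooth_on_def Ck_on_bounded_linear)

lemma smooth_on_linear:
  assumes "open S" "bounded_linear L"
  shows "smooth_on S L"
proof -
  have "Ck_on k (\<lambda>x. x) S" for k
    by (cases k) (auto simp: Ck_on_const)
  then show ?thesis
    using Ck_on_bounded_linear[OF assms] by (auto simp: smooth_on_def)
qed

lemma smooth_on_compose:
  fixes f :: "'a::real_normed_vector \<Rightarrow> 'b::euclidean_space"
  shows "open S \<Longrightarrow> open T \<Longrightarrow> f ` S \<subseteq> T \<Longrightarrow> smooth_on S f \<Longrightarrow> smooth_on T g \<Longrightarrow>
    smooth_on S (\<lambda>x. g (f x))"
  by (simp add: smooth_on_def Ck_on_compose)

lemma smooth_on_cong:
  "open S \<Longrightarrow> (\<And>x. x \<in> S \<Longrightarrow> f x = g x) \<Longrightarrow> smooth_on S f \<Longrightarrow> smooth_on S g"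
  unfolding smooth_on_def using Ck_on_cong by blast

lemma smooth_on_subset: "smooth_on S f \<Longrightarrow> T \<subseteq> S \<Longrightarrow> smooth_on T f"
  unfolding smooth_on_def using Ck_on_subset by blast

text \<open>Cramer's rule expresses the derivative of the inverse by the derivative of the map with
  field operations only, so each order of differentiability passes to the next.\<close>

lemma smooth_on_inverse_map:
  fixes f g :: "real^'n \<Rightarrow> real^'n"
  assumes "open S" "open T" "smooth_on S f"
    and inj: "\<And>x. x \<in> S \<Longrightarrow> inj (frechet_derivative f (at x))"
    and g: "continuous_on T g" "g ` T \<subseteq> S" "\<And>y. y \<in> T \<Longrightarrow> f (g y) = y"
  shows "smooth_on T g"
proof -
  define A where "A x = matrix (frechet_derivative f (at x))" for x
  have df: "(f has_derivative frechet_derivative f (at x)) (at x)" if "x \<in> S" for x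
    using smooth_on_has_derivative assms(3) that .
  have lin: "linear (frechet_derivative f (at x))" if "x \<in> S" for x
    using df[OF that] has_derivative_linear by blast
  have det: "det (A x) \<noteq> 0" if "x \<in> S" for x
    unfolding A_def using det_nz_iff_inj[OF lin[OF that]] inj[OF that] by simp
  \<comment> \<open>Column \<open>k\<close> is replaced by \<open>v\<close>: Cramer's solution
    \<open>w\<close> of \<open>A x *v w = v\<close>, written without \<open>inv\<close> so that its
    dependence on \<open>x\<close> is explicit.\<close>
  define Q :: "real^'n \<Rightarrow> real^'n \<Rightarrow> real^'n" where
    "Q x v = (\<chi> k. det (\<chi> i j. if j = k then v $ i else A x $ i $ j) * inverse (det (A x)))" for x v
  have Q: "Q x = inv (frechet_derivative f (at x))" if x: "x \<in> S" for x
  proof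
    fix v
    have "surj (frechet_derivative f (at x))"
      using linear_inj_imp_surj[OF lin[OF x] inj[OF x]] .
    then have "A x *v (inv (frechet_derivative f (at x)) v) = v"
      unfolding A_def by (simp add: matrix_works[OF lin[OF x, folded linear_matrix_vector_mul_eq]] surj_f_inv_f)
    then show "Q x v = inv (frechet_derivative f (at x)) v"
      unfolding cramer[OF det[OF x]] Q_def by (simp add: divide_inverse)
  qed
  \<comment> \<open>Continuity of \<open>g\<close> and invertibility of the derivative of
    \<open>f\<close> make \<open>g\<close> differentiable. Its derivative contains \<open>g\<close>
    itself undifferentiated, which is what the induction on the order feeds on.\<close>
  have dg: "(g has_derivative Q (g y)) (at y)" if y: "y \<in> T" for y
  proof -
    have gy: "g y \<in> S" using y g(2) by auto
    show ?thesis
      unfolding Q[OF gy]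
    proof (rule has_derivative_inverse_basic[OF df[OF gy] _ _ _ assms(2) y g(3)])
      show "bounded_linear (inv (frechet_derivative f (at (g y))))"
        using inj_linear_imp_inv_linear[OF lin[OF gy] inj[OF gy]] linear_conv_bounded_linear by blast
      show "inv (frechet_derivative f (at (g y))) \<circ> frechet_derivative f (at (g y)) = id"
        using inj[OF gy] by simp
      show "continuous (at y) g"
        using g(1) assms(2) y by (simp add: continuous_on_eq_continuous_at)
    qed
  qed
  have Ak: "Ck_on k (\<lambda>x. A x $ i $ j) S" for k i j
    unfolding A_def matrix_def vec_lambda_beta
    by (rule Ck_on_bounded_linear[OF assms(1) bounded_linear_vec_nth])
       (use assms(3)[unfolded smooth_on_def, rule_format, of "Suc k"] in simp)
  have detk: "Ck_on k (\<lambda>x. det (M x)) S" if "\<And>i j. Ck_on k (\<lambda>x. M x $ i $ j) S" for k and M :: "_ \<Rightarrow> real^'n^'n"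
    unfolding det_def by (intro Ck_on_sum Ck_on_mult Ck_on_prod Ck_on_const assms(1) that)
  have Qk: "Ck_on k (\<lambda>x. Q x v) S" for k v
  proof (rule Ck_on_vec_lambda[OF assms(1)], unfold Q_def vec_lambda_beta, intro Ck_on_mult Ck_on_inverse detk assms(1) det Ak)
    fix i j l
    show "Ck_on k (\<lambda>x. (\<chi> i j. if j = l then v $ i else A x $ i $ j) $ i $ j) S"
      by (cases "j = l") (auto intro: Ck_on_const Ak)
  qed
  have "Ck_on k g T" for k
  proof (induction k)
    case 0
    then show ?case using g(1) by simp
  next
    case (Suc k)
    show ?case
      by (rule Ck_on_SucI[OF assms(2) dg]) (auto intro!: Ck_on_compose[OF assms(2,1) g(2) Suc Qk])
  qed
  then show ?thesis by (simp add: smooth_on_def)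
qed

section \<open>Symmetry of second derivatives\<close>

text \<open>The mean value theorem is used twice: along \<open>u\<close>, for the difference of
  \<open>g\<close> across \<open>t *\<^sub>R v\<close>, and along \<open>v\<close>, for the
  derivative so obtained. The second difference does not change when \<open>u\<close> and
  \<open>v\<close> are exchanged, so it links the two mixed derivatives at nearby points.\<close>

lemma second_difference_mean_value:
  fixes g :: "'a::real_normed_vector \<Rightarrow> real"
  assumes t: "0 < t"
    and S: "\<And>s r. 0 \<le> s \<Longrightarrow> s \<le> t \<Longrightarrow> 0 \<le> r \<Longrightarrow> r \<le> t \<Longrightarrow> x + s *\<^sub>R u + r *\<^sub>R v \<in> S"
    and dg: "\<And>y. y \<in> S \<Longrightarrow> (g has_derivative g' y) (at y)"
    and dg': "\<And>y. y \<in> S \<Longrightarrow> ((\<lambda>y. g' y u) has_derivative g'' y) (at y)"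
  shows "\<exists>s r. 0 \<le> s \<and> s \<le> t \<and> 0 \<le> r \<and> r \<le> t \<and>
    g (x + t *\<^sub>R u + t *\<^sub>R v) - g (x + t *\<^sub>R u) - g (x + t *\<^sub>R v) + g x
      = t\<^sup>2 * g'' (x + s *\<^sub>R u + r *\<^sub>R v) v"
proof -
  define k where "k s = g (x + s *\<^sub>R u + t *\<^sub>R v) - g (x + s *\<^sub>R u)" for s
  have dk: "(k has_real_derivative g' (x + s *\<^sub>R u + t *\<^sub>R v) u - g' (x + s *\<^sub>R u) u) (at s)"
    if "0 \<le> s" "s \<le> t" for s
  proof -
    have "((\<lambda>s. x + s *\<^sub>R u + r *\<^sub>R v) has_derivative (\<lambda>h. h *\<^sub>R u)) (at s)" for r
      by (auto intro!: derivative_eq_intros)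
    from has_derivative_compose[OF this dg]
    have *: "((\<lambda>s. g (x + s *\<^sub>R u + r *\<^sub>R v)) has_derivative
       (\<lambda>h. g' (x + s *\<^sub>R u + r *\<^sub>R v) (h *\<^sub>R u))) (at s)" if "0 \<le> r" "r \<le> t" for r
      using S that \<open>0 \<le> s\<close> \<open>s \<le> t\<close> by blast
    have "linear (g' (x + s *\<^sub>R u + r *\<^sub>R v))" if "0 \<le> r" "r \<le> t" for r
      using dg[OF S] that \<open>0 \<le> s\<close> \<open>s \<le> t\<close> has_derivative_linear by blast
    then have **: "((\<lambda>s. g (x + s *\<^sub>R u + r *\<^sub>R v)) has_real_derivative
        g' (x + s *\<^sub>R u + r *\<^sub>R v) u) (at s)" if "0 \<le> r" "r \<le> t" for r
      using *[OF that] that unfolding has_field_derivative_def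
      by (simp add: linear_cmul mult_commute_abs)
    show ?thesis
      unfolding k_def using DERIV_diff[OF **[of t] **[of 0]] t by simp
  qed
  obtain s where s: "0 < s" "s < t" "k t - k 0 = t * (g' (x + s *\<^sub>R u + t *\<^sub>R v) u - g' (x + s *\<^sub>R u) u)"
    using MVT2[OF t dk] by auto
  have dl: "((\<lambda>r. g' (x + s *\<^sub>R u + r *\<^sub>R v) u) has_real_derivative g'' (x + s *\<^sub>R u + r *\<^sub>R v) v) (at r)"
    if "0 \<le> r" "r \<le> t" for r
  proof -
    have y: "x + s *\<^sub>R u + r *\<^sub>R v \<in> S" using S s that by simp
    have "((\<lambda>r. x + s *\<^sub>R u + r *\<^sub>R v) has_derivative (\<lambda>h. h *\<^sub>R v)) (at r)"
      by (auto intro!: derivative_eq_intros)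
    from has_derivative_compose[OF this dg'[OF y]] has_derivative_linear[OF dg'[OF y]]
    show ?thesis unfolding has_field_derivative_def
      by (simp add: linear_cmul mult_commute_abs)
  qed
  obtain r where r: "0 < r" "r < t"
    "g' (x + s *\<^sub>R u + t *\<^sub>R v) u - g' (x + s *\<^sub>R u) u = t * g'' (x + s *\<^sub>R u + r *\<^sub>R v) v"
    using MVT2[OF t dl] by auto
  have "g (x + t *\<^sub>R u + t *\<^sub>R v) - g (x + t *\<^sub>R u) - g (x + t *\<^sub>R v) + g x = k t - k 0"
    by (simp add: k_def)
  also have "\<dots> = t\<^sup>2 * g'' (x + s *\<^sub>R u + r *\<^sub>R v) v"
    using s r by (simp add: power2_eq_square)
  finally show ?thesis using s r by (intro exI[of _ s] exI[of _ r]) auto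
qed

lemma second_derivative_symmetric_real:
  fixes g :: "'a::real_normed_vector \<Rightarrow> real"
  assumes S: "open S" "x \<in> S" and g: "Ck_on 2 g S"
  shows "frechet_derivative (\<lambda>y. frechet_derivative g (at y) u) (at x) v
       = frechet_derivative (\<lambda>y. frechet_derivative g (at y) v) (at x) u"
proof (rule ccontr)
  define D where "D u v y = frechet_derivative (\<lambda>y. frechet_derivative g (at y) u) (at y) v" for u v y
  assume "\<not> ?thesis"
  then have e: "dist (D u v x) (D v u x) > 0" (is "?e > 0") by (simp add: D_def)
  have g1: "Ck_on (Suc (Suc 0)) g S" using g by (simp add: numeral_2_eq_2)
  have "continuous_on S (D u v)" for u v using g1 unfolding D_def by simp
  then have "continuous (at x) (D u v)" for u v
    using S continuous_on_eq_continuous_at by blast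
  then have "\<forall>\<^sub>F y in nhds x. dist (D u v y) (D u v x) < ?e / 2" for u v
    using e tendstoD[of "D u v" "D u v x" "nhds x" "?e / 2"]
    by (simp add: continuous_at tendsto_at_iff_tendsto_nhds)
  moreover have "\<forall>\<^sub>F y in nhds x. y \<in> S" using S eventually_nhds_in_open by blast
  ultimately have "\<forall>\<^sub>F y in nhds x. y \<in> S \<and> dist (D u v y) (D u v x) < ?e / 2 \<and> dist (D v u y) (D v u x) < ?e / 2"
    by (simp add: eventually_conj)
  then obtain d where d: "d > 0" and near: "\<And>y. dist y x < d \<Longrightarrow>
      y \<in> S \<and> dist (D u v y) (D u v x) < ?e / 2 \<and> dist (D v u y) (D v u x) < ?e / 2"
    unfolding eventually_nhds_metric by blast
  \<comment> \<open>The summand 1 keeps \<open>n\<close> positive even if \<open>u\<close> and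
    \<open>v\<close> vanish. Since \<open>t * n\<close> is half of \<open>d\<close>, the whole
    parallelogram stays in the ball.\<close>
  define n where "n = norm u + norm v + 1"
  define t where "t = d / 2 / n"
  have N: "n > 0" by (simp add: n_def add_nonneg_pos)
  then have t0: "t > 0" using d by (simp add: t_def)
  then have "t * (norm u + norm v) \<le> t * n" by (simp add: n_def)
  also have "\<dots> < d" using N d by (simp add: t_def)
  finally have t: "t > 0" "t * (norm u + norm v) < d" using t0 by auto
  have ball: "dist (x + s *\<^sub>R u + r *\<^sub>R v) x < d" if "0 \<le> s" "s \<le> t" "0 \<le> r" "r \<le> t" for s r
  proof -
    have "dist (x + s *\<^sub>R u + r *\<^sub>R v) x \<le> s * norm u + r * norm v"
      using norm_triangle_ineq[of "s *\<^sub>R u" "r *\<^sub>R v"] that by (simp add: dist_norm add.assoc)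
    also have "\<dots> \<le> t * norm u + t * norm v"
      using that by (intro add_mono mult_right_mono) auto
    finally show ?thesis using t by (simp add: distrib_left)
  qed
  have ball': "x + s *\<^sub>R u + r *\<^sub>R v \<in> ball x d"
    and ball'': "x + s *\<^sub>R v + r *\<^sub>R u \<in> ball x d" if "0 \<le> s" "s \<le> t" "0 \<le> r" "r \<le> t" for s r
    using ball[OF that] ball[OF that(3,4,1,2)] by (simp_all add: dist_commute add_ac)
  have dg: "(g has_derivative frechet_derivative g (at y)) (at y)"
    and dg': "((\<lambda>y. frechet_derivative g (at y) w) has_derivative (\<lambda>z. D w z y)) (at y)"
    if "y \<in> ball x d" for y w
    using near[of y] that g1 unfolding D_def
    by (auto simp: dist_commute frechet_derivative_works[symmetric])
  obtain s r where 1: "0 \<le> s" "s \<le> t" "0 \<le> r" "r \<le> t"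
    "g (x + t *\<^sub>R u + t *\<^sub>R v) - g (x + t *\<^sub>R u) - g (x + t *\<^sub>R v) + g x
      = t\<^sup>2 * D u v (x + s *\<^sub>R u + r *\<^sub>R v)"
    using second_difference_mean_value[where x=x and u=u and v=v, OF t(1) ball' dg dg'[where w=u]]
    by blast
  obtain s' r' where 2: "0 \<le> s'" "s' \<le> t" "0 \<le> r'" "r' \<le> t"
    "g (x + t *\<^sub>R v + t *\<^sub>R u) - g (x + t *\<^sub>R v) - g (x + t *\<^sub>R u) + g x
      = t\<^sup>2 * D v u (x + s' *\<^sub>R v + r' *\<^sub>R u)"
    using second_difference_mean_value[where x=x and u=v and v=u, OF t(1) ball'' dg dg'[where w=v]]
    by blast
  have "t\<^sup>2 * D u v (x + s *\<^sub>R u + r *\<^sub>R v) = t\<^sup>2 * D v u (x + s' *\<^sub>R v + r' *\<^sub>R u)"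
    using 1(5) 2(5) by (simp add: algebra_simps)
  then have "D u v (x + s *\<^sub>R u + r *\<^sub>R v) = D v u (x + r' *\<^sub>R u + s' *\<^sub>R v)"
    using t by (simp add: algebra_simps)
  \<comment> \<open>A common value would lie within less than half of the gap \<open>?e\<close> from
    two numbers whose distance is \<open>?e\<close>.\<close>
  then show False
    using near[OF ball[OF 1(1-4)]] near[OF ball[OF 2(3,4,1,2)]]
      dist_triangle3[of "D u v x" "D v u x" "D u v (x + s *\<^sub>R u + r *\<^sub>R v)"]
    by auto
qed

text \<open>Pairing with a fixed vector \<open>b\<close> commutes with both derivatives, which
  reduces the claim to real values; inner products with all \<open>b\<close> determine a
  vector.\<close>

lemma second_derivative_symmetric:
  fixes f :: "'a::real_normed_vector \<Rightarrow> 'b::real_inner"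
  assumes S: "open S" "x \<in> S" and f: "Ck_on 2 f S"
  shows "frechet_derivative (\<lambda>y. frechet_derivative f (at y) u) (at x) v
       = frechet_derivative (\<lambda>y. frechet_derivative f (at y) v) (at x) u" (is "?L = ?R")
proof -
  have "?L \<bullet> b = ?R \<bullet> b" for b
  proof -
    have g1: "Ck_on (Suc (Suc 0)) f S" using f by (simp add: numeral_2_eq_2)
    have 1: "frechet_derivative (\<lambda>y. f y \<bullet> b) (at y) w = frechet_derivative f (at y) w \<bullet> b" if "y \<in> S" for y w
      using frechet_derivative_at[OF has_derivative_inner_left[OF Ck_on_has_derivative[OF g1 that]]] by metis
    have 2: "frechet_derivative (\<lambda>y. frechet_derivative (\<lambda>y. f y \<bullet> b) (at y) w) (at x) z
        = frechet_derivative (\<lambda>y. frechet_derivative f (at y) w) (at x) z \<bullet> b" for w z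
    proof -
      have "Ck_on (Suc 0) (\<lambda>y. frechet_derivative f (at y) w) S" using g1 by simp
      from has_derivative_inner_left[OF Ck_on_has_derivative[OF this S(2)]]
      have "((\<lambda>y. frechet_derivative (\<lambda>y. f y \<bullet> b) (at y) w) has_derivative
         (\<lambda>z. frechet_derivative (\<lambda>y. frechet_derivative f (at y) w) (at x) z \<bullet> b)) (at x)"
        by (rule has_derivative_transform_within_open[OF _ S]) (simp add: 1)
      then show ?thesis using frechet_derivative_at by metis
    qed
    have "Ck_on 2 (\<lambda>y. f y \<bullet> b) S"
      using Ck_on_bounded_linear[OF S(1) bounded_linear_inner_left f] .
    from second_derivative_symmetric_real[OF S this, of u v] show ?thesis by (simp add: 2)
  qed
  then show ?thesis by (metis vector_eq_rdot)
qed

section \<open>Inversion between spaces of equal real dimension\<close>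

text \<open>Cramer's rule wants a square real matrix, but the inverse in question leads from
  \<open>complex^1\<close> to \<open>real^2\<close>. A linear isomorphism \<open>L\<close> with
  inverse \<open>K\<close> carries the target to \<open>real^'n\<close> and back.\<close>

lemma smooth_on_inverse_map_dim:
  fixes f :: "real^'n \<Rightarrow> 'b::euclidean_space" and g :: "'b \<Rightarrow> real^'n"
  assumes dim: "DIM('b) = CARD('n)"
    and S: "open S" and T: "open T" and f: "smooth_on S f"
    and inj: "\<And>x. x \<in> S \<Longrightarrow> inj (frechet_derivative f (at x))"
    and g: "continuous_on T g" "g ` T \<subseteq> S" "\<And>y. y \<in> T \<Longrightarrow> f (g y) = y"
  shows "smooth_on T g"
proof -
  have "DIM('b) = DIM(real^'n)" using dim by simp
  then obtain L :: "'b \<Rightarrow> real^'n" and K where L: "linear L" and K: "linear K"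
    and KL: "\<And>y. K (L y) = y" and LK: "\<And>x. L (K x) = x"
    using isomorphisms_UNIV_UNIV by metis
  have bl: "bounded_linear L" "bounded_linear K"
    using L K linear_conv_bounded_linear by blast+
  have T': "open (K -` T)" using T linear_continuous_on[OF bl(2)] by (rule open_vimage)
  have "smooth_on (K -` T) (\<lambda>x. g (K x))"
  proof (rule smooth_on_inverse_map[OF S T' smooth_on_bounded_linear[OF S bl(1) f]])
    show "inj (frechet_derivative (\<lambda>x. L (f x)) (at x))" if "x \<in> S" for x
    proof -
      have "((\<lambda>x. L (f x)) has_derivative (\<lambda>v. L (frechet_derivative f (at x) v))) (at x)"
        using bounded_linear.has_derivative[OF bl(1) smooth_on_has_derivative[OF f that]] .
      from frechet_derivative_at[OF this, symmetric]
      show ?thesis using inj[OF that] KL unfolding inj_def by metis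
    qed
    show "continuous_on (K -` T) (\<lambda>x. g (K x))"
      using g(1) linear_continuous_on[OF bl(2)] by (rule continuous_on_compose2) auto
    show "(\<lambda>x. g (K x)) ` (K -` T) \<subseteq> S" using g(2) by auto
    show "L (f (g (K y))) = y" if "y \<in> K -` T" for y using that g(3) LK by simp
  qed
  moreover have "L ` T \<subseteq> K -` T" by (auto simp: KL)
  ultimately have "smooth_on T (\<lambda>y. g (K (L y)))"
    using smooth_on_compose[OF T T' _ smooth_on_linear[OF T bl(1)], of "\<lambda>x. g (K x)"] by blast
  then show ?thesis by (simp only: KL)
qed

text \<open>The inverse function theorem, in the form that a chart requires: images of all open
  subsets are open, and the derivative stays injective on all of \<open>U\<close>, not just at
  \<open>x0\<close>.\<close>

lemma smooth_on_local_inverse: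
  fixes f :: "real^'n \<Rightarrow> 'b::euclidean_space"
  assumes dim: "DIM('b) = CARD('n)"
    and S: "open S" and f: "smooth_on S f" and x0: "x0 \<in> S" "inj (frechet_derivative f (at x0))"
  obtains U where "open U" "x0 \<in> U" "U \<subseteq> S" "inj_on f U"
    "\<And>V. open V \<Longrightarrow> V \<subseteq> U \<Longrightarrow> open (f ` V)"
    "\<And>x. x \<in> U \<Longrightarrow> inj (frechet_derivative f (at x))"
proof -
  have "DIM('b) = DIM(real^'n)" using dim by simp
  then obtain L :: "'b \<Rightarrow> real^'n" and K where L: "linear L" and K: "linear K"
    and KL: "\<And>y. K (L y) = y" and LK: "\<And>x. L (K x) = x"
    using isomorphisms_UNIV_UNIV by metis
  have bl: "bounded_linear L" using L linear_conv_bounded_linear by blast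
  define h where "h = (\<lambda>x. L (f x))"
  define h' where "h' x = Blinfun (\<lambda>v. L (frechet_derivative f (at x) v))" for x
  have dh: "(h has_derivative (\<lambda>v. L (frechet_derivative f (at x) v))) (at x)" if "x \<in> S" for x
    unfolding h_def using bounded_linear.has_derivative[OF bl smooth_on_has_derivative[OF f that]] .
  have h': "blinfun_apply (h' x) = (\<lambda>v. L (frechet_derivative f (at x) v))" if "x \<in> S" for x
    unfolding h'_def using has_derivative_bounded_linear[OF dh[OF that]] by (rule bounded_linear_Blinfun_apply)
  have cont: "continuous_on S h'"
  \<comment> \<open>In finite dimension, continuity in the operator norm can be tested on fixed
    directions, where it is the first-order part of the smoothness of \<open>f\<close>.\<close>
  proof (rule continuous_on_blinfun_componentwise)
    fix i :: "real^'n"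
    have "continuous_on S (\<lambda>x. frechet_derivative f (at x) i)"
      using f[unfolded smooth_on_def, rule_format, of "Suc 0"] by simp
    then have "continuous_on S (\<lambda>x. L (frechet_derivative f (at x) i))"
      by (rule bounded_linear.continuous_on[OF bl])
    then show "continuous_on S (\<lambda>x. h' x i)"
      by (rule continuous_on_eq) (simp add: h')
  qed
  have "inj (blinfun_apply (h' x0))"
    using x0 KL unfolding h'[OF x0(1)] inj_def by metis
  then obtain Q where Q: "linear Q" "Q \<circ> blinfun_apply (h' x0) = id"
    using linear_injective_left_inverse[OF blinfun.bounded_linear_right[THEN bounded_linear.linear]] by blast
  then have "bounded_linear Q" using linear_conv_bounded_linear by blast
  then have Qh': "Blinfun Q o\<^sub>L h' x0 = id_blinfun"
    using Q(2) by (intro blinfun_eqI) (simp add: bounded_linear_Blinfun_apply fun_eq_iff)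
  have dh': "(h has_derivative blinfun_apply (h' x)) (at x)" if "x \<in> S" for x
    using dh h' that by simp
  obtain U V g where U: "open U" "U \<subseteq> S" "x0 \<in> U" "open V" "homeomorphism U V h g"
    and V: "\<And>y. y \<in> V \<Longrightarrow> bij (blinfun_apply (h' (g y)))"
    using inverse_function_theorem[OF S dh' cont x0(1) Qh', of thesis] by blast
  show ?thesis
  proof (rule that[OF U(1,3,2)])
    have "inj_on h U"
      using U(5) by (intro inj_on_inverseI[of U g]) (simp add: homeomorphism_def)
    then show "inj_on f U"
      unfolding h_def using inj_on_imageI2[of L f U] by (simp add: comp_def)
    show "open (f ` W)" if "open W" "W \<subseteq> U" for W
    proof -
      have "openin (top_of_set U) W" using that U(1) by (simp add: openin_open_eq)
      then have "openin (top_of_set V) (h ` W)" using homeomorphism_imp_open_map[OF U(5)] by blast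
      then have "open (h ` W)" using U(4) openin_open_trans by blast
      moreover have "f ` W = L -` (h ` W)"
        unfolding h_def using KL by (auto simp: image_iff) metis
      ultimately show ?thesis
        using linear_continuous_on[OF bl, of UNIV] by (simp add: open_vimage)
    qed
    show "inj (frechet_derivative f (at x))" if x: "x \<in> U" for x
    proof -
      have "h x \<in> V" "g (h x) = x" using U(5) x by (auto simp: homeomorphism_def)
      then have "inj (\<lambda>v. L (frechet_derivative f (at x) v))"
        using V[of "h x"] h'[of x] x U(2) bij_is_inj by force
      then show ?thesis unfolding inj_def by metis
    qed
  qed
qed

section \<open>Charts and differentials\<close>

lemma fst_chart_subset: "chart_on X c \<Longrightarrow> fst c \<subseteq> topspace X"
  by (simp add: chart_on_def openin_subset)

lemma inj_on_chart: "chart_on X c \<Longrightarrow> inj_on (snd c) (fst c)"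
  using homeomorphic_imp_injective_map[of "subtopology X (fst c)" _ "snd c"] fst_chart_subset[of X c]
  by (auto simp: chart_on_def Int_absorb1)

lemma chart_inv_chart: "chart_on X c \<Longrightarrow> p \<in> fst c \<Longrightarrow> chart_inv c (snd c p) = p"
  using inj_on_chart inv_into_f_f by metis

lemma open_chart_image:
  assumes "chart_on X c" "openin X U" "U \<subseteq> fst c"
  shows "open (snd c ` U)"
proof -
  have "open_map (subtopology X (fst c)) (top_of_set (snd c ` fst c)) (snd c)"
    using assms(1) homeomorphic_imp_open_map unfolding chart_on_def by blast
  moreover have "openin (subtopology X (fst c)) U"
    using assms by (simp add: chart_on_def openin_open_subtopology)
  ultimately have "openin (top_of_set (snd c ` fst c)) (snd c ` U)"
    unfolding open_map_def by blast
  then show ?thesis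
    using assms(1) openin_open_trans unfolding chart_on_def by blast
qed

lemma continuous_map_chart:
  assumes "chart_on X c"
  shows "continuous_map (subtopology X (fst c)) euclidean (snd c)"
  using assms homeomorphic_imp_continuous_map continuous_map_into_fulltopology
  unfolding chart_on_def by blast

lemma continuous_map_chart_inv:
  assumes "chart_on X c"
  shows "continuous_map (top_of_set (snd c ` fst c)) X (chart_inv c)"
proof -
  have ts: "topspace (subtopology X (fst c)) = fst c"
    using fst_chart_subset[OF assms] by auto
  have "homeomorphic_map (subtopology X (fst c)) (top_of_set (snd c ` fst c)) (snd c)"
    using assms by (simp add: chart_on_def)
  then have "open_map (subtopology X (fst c)) (top_of_set (snd c ` fst c)) (snd c)"
    by (rule homeomorphic_imp_open_map)
  then have "continuous_map (top_of_set (snd c ` fst c)) (subtopology X (fst c)) (chart_inv c)"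
    by (subst open_eq_continuous_inverse_map[symmetric])
       (auto simp: ts chart_inv_chart[OF assms] simp del: topspace_subtopology)
  then show ?thesis by (rule continuous_map_into_fulltopology)
qed

section \<open>Local representatives of maps\<close>

lemma local_domI: "p \<in> fst c \<Longrightarrow> F p \<in> fst d \<Longrightarrow> snd c p \<in> local_dom c F d"
  by (auto simp: local_dom_def)

lemma local_domE:
  assumes "z \<in> local_dom c F d"
  obtains p where "p \<in> fst c" "F p \<in> fst d" "z = snd c p"
  using assms by (auto simp: local_dom_def)

lemma local_rep_chart: "chart_on X c \<Longrightarrow> p \<in> fst c \<Longrightarrow> local_rep c F d (snd c p) = snd d (F p)"
  by (simp add: local_rep_def chart_inv_chart)

lemma open_local_dom:
  assumes "chart_on X c" "chart_on Y d" "continuous_map X Y F"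
  shows "open (local_dom c F d)"
  unfolding local_dom_def using assms
  by (intro open_chart_image[OF assms(1)] openin_continuous_map_preimage_gen[OF assms(3)])
     (auto simp: chart_on_def)

lemma continuous_on_local_rep:
  assumes "chart_on X c" "chart_on Y d" "continuous_map X Y F"
  shows "continuous_on (local_dom c F d) (local_rep c F d)"
proof -
  let ?S = "local_dom c F d"
  have "continuous_map (top_of_set ?S) X (chart_inv c)"
    using continuous_map_chart_inv[OF assms(1)]
    by (rule continuous_map_from_subtopology_mono) (auto simp: local_dom_def)
  then have "continuous_map (top_of_set ?S) Y (F \<circ> chart_inv c)"
    using assms(3) continuous_map_compose by blast
  moreover have "(F \<circ> chart_inv c) \<in> ?S \<rightarrow> fst d"
    by (auto simp: local_dom_def chart_inv_chart[OF assms(1)])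
  ultimately have "continuous_map (top_of_set ?S) (subtopology Y (fst d)) (F \<circ> chart_inv c)"
    by (simp add: continuous_map_in_subtopology)
  from continuous_map_compose[OF this continuous_map_chart[OF assms(2)]]
  show ?thesis by (simp add: local_rep_def comp_def)
qed

text \<open>The chart \<open>d\<close> cancels over \<open>local_dom c F d\<close>, an open set by
  continuity of \<open>F\<close>, so the derivative at the point is that of the composite. The
  derivatives are hypotheses and no atlas is mentioned; so the rule applies to charts whose
  compatibility is still to be proved.\<close>

lemma local_rep_has_derivative_compose:
  assumes "chart_on X c" "chart_on Y d" "continuous_map X Y F" and p: "p \<in> fst c" "F p \<in> fst d"
    and 1: "(local_rep c F d has_derivative D) (at (snd c p))"
    and 2: "(local_rep d G e has_derivative E) (at (snd d (F p)))"
  shows "(local_rep c (\<lambda>q. G (F q)) e has_derivative (\<lambda>v. E (D v))) (at (snd c p))"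
proof (rule has_derivative_transform_within_open[OF _ open_local_dom[OF assms(1-3)] local_domI[where F=F, OF p]])
  show "((\<lambda>z. local_rep d G e (local_rep c F d z)) has_derivative (\<lambda>v. E (D v))) (at (snd c p))"
    using has_derivative_compose[OF 1] 2 local_rep_chart[OF assms(1) p(1), of F d] by simp
  show "local_rep d G e (local_rep c F d z) = local_rep c (\<lambda>q. G (F q)) e z" if "z \<in> local_dom c F d" for z
    using that
    by (elim local_domE) (simp add: local_rep_chart[OF assms(1)] local_rep_chart[OF assms(2)])
qed

section \<open>First-order calculus shared by real and complex manifolds\<close>

text \<open>A common weakening of \<open>smooth_map\<close> and \<open>holomorphic_map\<close>:
  tangent vectors and differentials depend on one derivative only, and their rules are then
  available for the real and the complex atlas of \<open>M\<close> alike.\<close>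

definition differentiable_map ::
  "'x topology \<Rightarrow> ('x, 'v::real_normed_vector) chart set \<Rightarrow>
   'y topology \<Rightarrow> ('y, 'w::real_normed_vector) chart set \<Rightarrow> ('x \<Rightarrow> 'y) \<Rightarrow> bool" where
  "differentiable_map X A Y B F \<longleftrightarrow> continuous_map X Y F \<and>
     (\<forall>c\<in>A. \<forall>d\<in>B. \<forall>z\<in>local_dom c F d. local_rep c F d differentiable (at z))"

definition differentiable_manifold :: "'x topology \<Rightarrow> ('x, 'v::real_normed_vector) chart set \<Rightarrow> bool" where
  "differentiable_manifold X A \<longleftrightarrow> topological_atlas X A \<and> differentiable_map X A X A (\<lambda>p. p)"

lemma smooth_imp_differentiable_map: "smooth_map X A Y B F \<Longrightarrow> differentiable_map X A Y B F"
  unfolding smooth_map_def differentiable_map_def differentiable_def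
  using smooth_on_has_derivative by blast

lemma holomorphic_imp_differentiable_map: "holomorphic_map X A Y B F \<Longrightarrow> differentiable_map X A Y B F"
  unfolding holomorphic_map_def differentiable_map_def differentiable_def holo_on_def by blast

lemma smooth_imp_differentiable_manifold: "smooth_manifold X A \<Longrightarrow> differentiable_manifold X A"
  unfolding differentiable_manifold_def
  using smooth_imp_differentiable_map[of X A X A "\<lambda>p. p"]
  by (auto simp: smooth_manifold_def smooth_map_def)

lemma complex_manifold_holomorphic_id: "complex_manifold X A \<Longrightarrow> holomorphic_map X A X A (\<lambda>p. p)"
  by (auto simp: complex_manifold_def holomorphic_map_def)

lemma complex_imp_differentiable_manifold: "complex_manifold X A \<Longrightarrow> differentiable_manifold X A"
  unfolding differentiable_manifold_def
  using holomorphic_imp_differentiable_map[OF complex_manifold_holomorphic_id]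
  by (simp add: complex_manifold_def)

lemma differentiable_manifold_chart:
  "differentiable_manifold X A \<Longrightarrow> c \<in> A \<Longrightarrow> chart_on X c"
  by (simp add: differentiable_manifold_def topological_atlas_def)

abbreviation rep_deriv :: "('x, 'v::real_normed_vector) chart \<Rightarrow> ('x \<Rightarrow> 'y) \<Rightarrow>
    ('y, 'w::real_normed_vector) chart \<Rightarrow> 'x \<Rightarrow> 'v \<Rightarrow> 'w" where
  "rep_deriv c F d p \<equiv> frechet_derivative (local_rep c F d) (at (snd c p))"

lemma rep_has_derivative:
  assumes "differentiable_map X A Y B F" "c \<in> charts_at A p" "d \<in> charts_at B (F p)"
  shows "(local_rep c F d has_derivative rep_deriv c F d p) (at (snd c p))"
  using assms local_domI[of p c F d]
  by (auto simp: differentiable_map_def charts_at_def frechet_derivative_works[symmetric])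

text \<open>With the identity for \<open>F\<close> or \<open>G\<close>, this chain rule is the
  change of chart in the source or in the target.\<close>

lemma rep_deriv_compose:
  assumes "differentiable_manifold X A" "differentiable_manifold Y B"
    and F: "differentiable_map X A Y B F" and G: "differentiable_map Y B Z C G"
    and cd: "c \<in> charts_at A p" "d \<in> charts_at B (F p)" and e: "e \<in> charts_at C (G (F p))"
  shows "rep_deriv c (\<lambda>q. G (F q)) e p v = rep_deriv d G e (F p) (rep_deriv c F d p v)"
proof -
  have "(local_rep c (\<lambda>q. G (F q)) e has_derivative (\<lambda>v. rep_deriv d G e (F p) (rep_deriv c F d p v)))
      (at (snd c p))"
  proof (rule local_rep_has_derivative_compose[where F=F and X=X and Y=Y and d=d])
    show "chart_on X c" "chart_on Y d" "p \<in> fst c" "F p \<in> fst d"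
      using cd assms(1,2)[THEN differentiable_manifold_chart] by (simp_all add: charts_at_def)
    show "continuous_map X Y F" using F by (simp add: differentiable_map_def)
  qed (fact rep_has_derivative[OF F cd] rep_has_derivative[OF G cd(2) e])+
  then show ?thesis using frechet_derivative_at by metis
qed

lemma rep_deriv_coord_change_self:
  assumes "differentiable_manifold X A" "c \<in> charts_at A p"
  shows "rep_deriv c (\<lambda>p. p) c p v = v"
proof -
  have c: "chart_on X c" "p \<in> fst c"
    using assms differentiable_manifold_chart[of X A c] by (simp_all add: charts_at_def)
  have "open (snd c ` fst c)" using c by (simp add: chart_on_def)
  then have "(coord_change c c has_derivative (\<lambda>v. v)) (at (snd c p))"
    by (rule has_derivative_transform_within_open[OF has_derivative_ident]) (auto simp: c local_rep_chart[OF c(1)])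
  then show ?thesis using frechet_derivative_at by metis
qed

text \<open>Any chart around \<open>p\<close> identifies the tangent space with the model space:
  \<open>coord_tvec A c p\<close> and evaluation at \<open>c\<close> are inverse to each other. The
  transformation law between two further charts is the chain rule for coordinate changes.\<close>

lemma
  assumes M: "differentiable_manifold X A" and c: "c \<in> charts_at A p"
  shows coord_tvec_in_tangent_space: "coord_tvec A c p u \<in> tangent_space A p"
    and coord_tvec_chart: "coord_tvec A c p u c = u"
    and tangent_space_eq_coord_tvec: "v \<in> tangent_space A p \<Longrightarrow> coord_tvec A c p (v c) = v"
proof -
  have id: "differentiable_map X A X A (\<lambda>p. p)" using M by (simp add: differentiable_manifold_def)
  show "coord_tvec A c p u \<in> tangent_space A p"
    unfolding tangent_space_def
  proof (intro CollectI conjI allI ballI impI)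
    fix d e assume "d \<in> charts_at A p" "e \<in> charts_at A p"
    then show "coord_tvec A c p u e = rep_deriv d (\<lambda>p. p) e p (coord_tvec A c p u d)"
      using rep_deriv_compose[OF M M id id c, of d e u] by (simp only: coord_tvec_def if_True)
  qed (simp add: coord_tvec_def)
  show "coord_tvec A c p u c = u"
    using c rep_deriv_coord_change_self[OF M c] by (simp add: coord_tvec_def)
  show "coord_tvec A c p (v c) = v" if "v \<in> tangent_space A p"
  proof
    fix d
    show "coord_tvec A c p (v c) d = v d"
    proof (cases "d \<in> charts_at A p")
      case True
      then have "v d = rep_deriv c (\<lambda>p. p) d p (v c)"
        using that c unfolding tangent_space_def by blast
      then show ?thesis by (simp only: coord_tvec_def True if_True)
    next
      case False
      then have "v d = 0" using that unfolding tangent_space_def by blast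
      then show ?thesis by (simp only: coord_tvec_def False if_False)
    qed
  qed
qed

lemma differential_coord_tvec:
  assumes M: "differentiable_manifold X A" and N: "differentiable_manifold Y B"
    and F: "differentiable_map X A Y B F"
    and c: "c \<in> charts_at A p" and d: "d \<in> charts_at B (F p)"
  shows "differential A B F p (coord_tvec A c p u) = coord_tvec B d (F p) (rep_deriv c F d p u)"
proof
  fix e
  have id: "differentiable_map X A X A (\<lambda>p. p)" "differentiable_map Y B Y B (\<lambda>p. p)"
    using M N by (simp_all add: differentiable_manifold_def)
  \<comment> \<open>This is the chart hidden in the definition of \<open>differential\<close>; the
    chain rule replaces it by the given \<open>c\<close>.\<close>
  define c' where "c' = (SOME c. c \<in> charts_at A p)"
  have c': "c' \<in> charts_at A p" unfolding c'_def using c by (rule someI)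
  show "differential A B F p (coord_tvec A c p u) e = coord_tvec B d (F p) (rep_deriv c F d p u) e"
  proof (cases "e \<in> charts_at B (F p)")
    case True
    have "differential A B F p (coord_tvec A c p u) e = rep_deriv c' F e p (rep_deriv c (\<lambda>p. p) c' p u)"
      using True c' by (simp add: differential_def c'_def[symmetric] coord_tvec_def Let_def)
    also have "\<dots> = rep_deriv c F e p u"
      using rep_deriv_compose[OF M M id(1) F c c' True] by simp
    also have "\<dots> = rep_deriv d (\<lambda>p. p) e (F p) (rep_deriv c F d p u)"
      using rep_deriv_compose[OF M N F id(2) c d, of e] True by simp
    finally show ?thesis using True by (simp add: coord_tvec_def)
  qed (simp add: differential_def coord_tvec_def Let_def)
qed

lemma immersion_inj_rep_deriv:
  assumes M: "differentiable_manifold X A" and N: "differentiable_manifold Y B"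
    and F: "differentiable_map X A Y B F" and im: "immersion X A Y B F"
    and c: "c \<in> charts_at A p" and d: "d \<in> charts_at B (F p)"
  shows "inj (rep_deriv c F d p)"
proof (rule injI)
  fix u w assume "rep_deriv c F d p u = rep_deriv c F d p w"
  then have "differential A B F p (coord_tvec A c p u) = differential A B F p (coord_tvec A c p w)"
    by (simp add: differential_coord_tvec[OF M N F c d])
  moreover have "p \<in> topspace X"
    using c fst_chart_subset differentiable_manifold_chart[OF M] unfolding charts_at_def by blast
  ultimately have "coord_tvec A c p u = coord_tvec A c p w"
    using im coord_tvec_in_tangent_space[OF M c] unfolding immersion_def by (meson inj_onD)
  then show "u = w" using coord_tvec_chart[OF M c] by metis
qed

lemma charts_at_nonempty:
  assumes "differentiable_manifold X A" "p \<in> topspace X"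
  obtains c where "c \<in> charts_at A p"
proof -
  have "p \<in> (\<Union>c\<in>A. fst c)"
    using assms by (simp add: differentiable_manifold_def topological_atlas_def)
  then show ?thesis using that by (auto simp only: charts_at_def)
qed

section \<open>Contact forms and Legendrian maps\<close>

lemma charts_atD:
  assumes "differentiable_manifold X A" "c \<in> charts_at A p"
  shows "c \<in> A" "p \<in> fst c" "chart_on X c" "chart_inv c (snd c p) = p" "p \<in> topspace X"
proof -
  show c: "c \<in> A" "p \<in> fst c" using assms(2) by (simp_all add: charts_at_def)
  show "chart_on X c" using differentiable_manifold_chart[OF assms(1) c(1)] .
  from chart_inv_chart[OF this c(2)] subsetD[OF fst_chart_subset[OF this] c(2)]
  show "chart_inv c (snd c p) = p" "p \<in> topspace X" .
qed

lemma complex_linear_expansion: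
  fixes D :: "complex^'n \<Rightarrow> complex^'m"
  assumes "linear D" "\<And>a v. D (a *s v) = a *s D v"
  shows "D v = (\<Sum>i\<in>UNIV. v $ i *s D (axis i 1))"
proof -
  have "D v = D (\<Sum>i\<in>UNIV. v $ i *s axis i 1)" by (simp only: basis_expansion)
  also have "\<dots> = (\<Sum>i\<in>UNIV. v $ i *s D (axis i 1))"
    by (simp only: linear_sum[OF assms(1)] assms(2))
  finally show ?thesis .
qed

lemma holo_on_has_derivative:
  assumes "holo_on S f" "z \<in> S"
  shows "(f has_derivative frechet_derivative f (at z)) (at z)"
    and "frechet_derivative f (at z) (a *s v) = a *s frechet_derivative f (at z) v"
proof -
  obtain D where D: "(f has_derivative D) (at z)" "\<forall>a v. D (a *s v) = a *s D v"
    using assms unfolding holo_on_def by blast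
  then have "frechet_derivative f (at z) = D" using frechet_derivative_at by metis
  then show "(f has_derivative frechet_derivative f (at z)) (at z)"
    "frechet_derivative f (at z) (a *s v) = a *s frechet_derivative f (at z) v"
    using D by simp_all
qed

lemma rep_deriv_complex_linear:
  assumes "complex_manifold X A" "c \<in> charts_at A p" "d \<in> charts_at A p"
  shows "linear (rep_deriv c (\<lambda>p. p) d p)"
    and "rep_deriv c (\<lambda>p. p) d p (a *s v) = a *s rep_deriv c (\<lambda>p. p) d p v"
proof -
  have "holo_on (coord_dom c d) (coord_change c d)"
    using assms by (simp add: complex_manifold_def charts_at_def)
  moreover have "snd c p \<in> coord_dom c d"
    using assms(2,3) by (intro local_domI) (simp_all add: charts_at_def)
  ultimately show "linear (rep_deriv c (\<lambda>p. p) d p)"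
    "rep_deriv c (\<lambda>p. p) d p (a *s v) = a *s rep_deriv c (\<lambda>p. p) d p v"
    using holo_on_has_derivative has_derivative_linear by blast+
qed

text \<open>Holomorphic coordinate changes have complex linear derivatives, so all charts agree on
  multiplication of tangent vectors by complex scalars.\<close>

lemma coord_tvec_complex_linear:
  assumes "complex_manifold X A" "c \<in> charts_at A p"
  shows "coord_tvec A c p (a *s u + b *s w) = (\<lambda>d. a *s coord_tvec A c p u d + b *s coord_tvec A c p w d)"
proof
  fix d
  show "coord_tvec A c p (a *s u + b *s w) d = a *s coord_tvec A c p u d + b *s coord_tvec A c p w d"
  proof (cases "d \<in> charts_at A p")
    case True
    then show ?thesis
      using linear_add[OF rep_deriv_complex_linear(1)[OF assms True]] rep_deriv_complex_linear(2)[OF assms True]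
      by (simp only: coord_tvec_def if_True)
  qed (simp add: coord_tvec_def)
qed

text \<open>Linearity of \<alpha> is given on tangent vectors; complex linearity of
  \<open>coord_tvec\<close> transfers it to coordinate vectors, which expand in the standard
  basis.\<close>

lemma form_rep_expansion:
  assumes X: "complex_manifold X A" and \<alpha>: "holomorphic_one_form A W \<alpha>"
    and c: "c \<in> charts_at A q" and q: "q \<in> W"
  shows "form_rep A \<alpha> c (snd c q) u = (\<Sum>j\<in>UNIV. u $ j * form_rep A \<alpha> c (snd c q) (axis j 1))"
proof -
  note M = complex_imp_differentiable_manifold[OF X]
  have \<phi>: "form_rep A \<alpha> c (snd c q) u = \<alpha> q (coord_tvec A c q u)" for u
    by (simp add: form_rep_def charts_atD(4)[OF M c])
  have lin: "form_rep A \<alpha> c (snd c q) (a *s u + b *s w)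
      = a * form_rep A \<alpha> c (snd c q) u + b * form_rep A \<alpha> c (snd c q) w" for a b u w
    using \<alpha> q coord_tvec_in_tangent_space[OF M c]
    unfolding \<phi> coord_tvec_complex_linear[OF X c] holomorphic_one_form_def by blast
  interpret additive "form_rep A \<alpha> c (snd c q)"
    by standard (use lin[of 1 _ 1] in simp)
  have "form_rep A \<alpha> c (snd c q) (a *s u) = a * form_rep A \<alpha> c (snd c q) u" for a u
    using lin[of a u 0 0] by simp
  then have "form_rep A \<alpha> c (snd c q) (\<Sum>j\<in>UNIV. u $ j *s axis j 1)
      = (\<Sum>j\<in>UNIV. u $ j * form_rep A \<alpha> c (snd c q) (axis j 1))"
    by (simp only: sum)
  then show ?thesis by (simp only: basis_expansion)
qed

text \<open>Here \<open>a\<close> and \<open>b\<close> are the coefficient vectors of \<open>\<alpha>\<close> and of \<open>\<beta>\<close>, the latter under the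
  identification of alternating 2-forms on \<open>\<complex>\<^sup>3\<close> with vectors. Then \<open>\<alpha> \<and> \<beta>\<close> is \<open>a \<bullet> b\<close> times
  the determinant, and the cross product \<open>N\<close> of two vectors in the common kernel satisfies
  \<open>0 = b \<times> (a \<times> N) = (b \<bullet> N) a - (a \<bullet> b) N = - (a \<bullet> b) N\<close>.\<close>

lemma wedge_kernel_minors:
  fixes a b :: "complex^3" and U V :: "complex^3"
  assumes \<alpha>: "\<And>u. \<alpha> u = a $ 1 * u $ 1 + a $ 2 * u $ 2 + a $ 3 * u $ 3"
    and \<beta>: "\<And>u v. \<beta> u v = b $ 1 * (u $ 2 * v $ 3 - u $ 3 * v $ 2)
      + b $ 2 * (u $ 3 * v $ 1 - u $ 1 * v $ 3) + b $ 3 * (u $ 1 * v $ 2 - u $ 2 * v $ 1)"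
    and nz: "wedge_1_2 \<alpha> \<beta> x y z \<noteq> 0"
    and 0: "\<alpha> U = 0" "\<alpha> V = 0" "\<beta> U V = 0"
  shows "U $ i * V $ j = U $ j * V $ i"
proof -
  define s where "s = a $ 1 * b $ 1 + a $ 2 * b $ 2 + a $ 3 * b $ 3"
  have "wedge_1_2 \<alpha> \<beta> x y z = s * (x $ 1 * (y $ 2 * z $ 3 - y $ 3 * z $ 2)
      + x $ 2 * (y $ 3 * z $ 1 - y $ 1 * z $ 3) + x $ 3 * (y $ 1 * z $ 2 - y $ 2 * z $ 1))"
    unfolding wedge_1_2_def \<alpha> \<beta> s_def by algebra
  then have s: "s \<noteq> 0" using nz by auto
  note eqs = 0[unfolded \<alpha> \<beta>]
  have "s * (U $ 1 * V $ 2 - U $ 2 * V $ 1) = 0" "s * (U $ 2 * V $ 3 - U $ 3 * V $ 2) = 0"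
    "s * (U $ 3 * V $ 1 - U $ 1 * V $ 3) = 0"
    unfolding s_def using eqs by algebra+
  then have m: "U $ 1 * V $ 2 = U $ 2 * V $ 1" "U $ 2 * V $ 3 = U $ 3 * V $ 2" "U $ 3 * V $ 1 = U $ 1 * V $ 3"
    using s by simp_all
  have "\<forall>i j. U $ i * V $ j = U $ j * V $ i"
    unfolding forall_3 using m by simp
  then show ?thesis by blast
qed

section \<open>Pullbacks of the contact form and of its exterior derivative\<close>

lemma legendrian_form_rep:
  assumes X: "complex_manifold X A" and M: "differentiable_manifold M B"
    and F: "differentiable_map M B X A F" and leg: "legendrian M B A \<xi> F"
    and \<xi>: "\<xi> (F p) = {v \<in> tangent_space A (F p). \<alpha> (F p) v = 0}"
    and b: "b \<in> charts_at B p" and d: "d \<in> charts_at A (F p)"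
  shows "form_rep A \<alpha> d (snd d (F p)) (rep_deriv b F d p u) = 0"
proof -
  note N = complex_imp_differentiable_manifold[OF X]
  note p = charts_atD(5)[OF M b]
  have "form_rep A \<alpha> d (snd d (F p)) (rep_deriv b F d p u)
      = \<alpha> (F p) (differential B A F p (coord_tvec B b p u))"
    by (simp add: form_rep_def charts_atD(4)[OF N d] differential_coord_tvec[OF M N F b d])
  also have "differential B A F p (coord_tvec B b p u) \<in> \<xi> (F p)"
    using leg p coord_tvec_in_tangent_space[OF M b] unfolding legendrian_def by blast
  then have "\<alpha> (F p) (differential B A F p (coord_tvec B b p u)) = 0" unfolding \<xi> by simp
  finally show ?thesis .
qed

text \<open>Holomorphy is known for the coefficient vector \<open>a\<close>, while
  \<open>ext_deriv\<close> differentiates the values on a constant vector. Near the point these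
  values are combinations of the coefficients with constant weights.\<close>

lemma ext_deriv_form_rep:
  assumes X: "complex_manifold X A" and \<alpha>: "holomorphic_one_form A W \<alpha>" and W: "openin X W"
    and d: "d \<in> charts_at A q" and q: "q \<in> W"
    and a: "a = (\<lambda>y. \<chi> j. form_rep A \<alpha> d y (axis j 1))"
  shows "ext_deriv (form_rep A \<alpha> d) (snd d q) u v
    = (\<Sum>j\<in>UNIV. frechet_derivative a (at (snd d q)) u $ j * v $ j)
      - (\<Sum>j\<in>UNIV. frechet_derivative a (at (snd d q)) v $ j * u $ j)"
proof -
  note N = complex_imp_differentiable_manifold[OF X]
  have d': "d \<in> A" "q \<in> fst d" using d by (auto simp: charts_at_def)
  note dc = differentiable_manifold_chart[OF N d'(1)]
  let ?S = "snd d ` (W \<inter> fst d)"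
  have S: "open ?S"
    using dc W by (intro open_chart_image[OF dc] openin_Int) (auto simp: chart_on_def)
  have holo: "holo_on ?S a" using \<alpha> d'(1) by (simp add: holomorphic_one_form_def a)
  have qS: "snd d q \<in> ?S" using q d'(2) by auto
  note da = holo_on_has_derivative(1)[OF holo qS]
  have "((\<lambda>y. form_rep A \<alpha> d y v) has_derivative
      (\<lambda>u. \<Sum>j\<in>UNIV. frechet_derivative a (at (snd d q)) u $ j * v $ j)) (at (snd d q))" for v
  proof (rule has_derivative_transform_within_open[OF _ S qS])
    show "((\<lambda>y. \<Sum>j\<in>UNIV. a y $ j * v $ j) has_derivative
        (\<lambda>u. \<Sum>j\<in>UNIV. frechet_derivative a (at (snd d q)) u $ j * v $ j)) (at (snd d q))"
      by (intro has_derivative_sum has_derivative_mult_left bounded_linear.has_derivative[OF bounded_linear_vec_nth] da)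
    show "(\<Sum>j\<in>UNIV. a y $ j * v $ j) = form_rep A \<alpha> d y v" if y: "y \<in> ?S" for y
    proof -
      obtain r where "y = snd d r" "r \<in> W" "r \<in> fst d" using y by blast
      then show ?thesis
        using form_rep_expansion[OF X \<alpha>, of d r v] d'(1) by (simp add: a charts_at_def mult.commute)
    qed
  qed
  note frechet_derivative_at[OF this, symmetric]
  then show ?thesis by (simp only: ext_deriv_def)
qed

text \<open>Since the derivative of the coefficients is complex linear, the exterior derivative is a
  complex bilinear alternating form, and on three-dimensional space such a form is given by pairing
  a vector with the cross product.\<close>

lemma ext_deriv_form_rep_cross:
  fixes A :: "('x, complex^3) chart set"
  assumes "complex_manifold X A" "holomorphic_one_form A W \<alpha>" "openin X W"
    and d: "d \<in> charts_at A q" and q: "q \<in> W"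
  obtains b :: "complex^3" where "\<And>u v. ext_deriv (form_rep A \<alpha> d) (snd d q) u v
    = b $ 1 * (u $ 2 * v $ 3 - u $ 3 * v $ 2)
      + b $ 2 * (u $ 3 * v $ 1 - u $ 1 * v $ 3) + b $ 3 * (u $ 1 * v $ 2 - u $ 2 * v $ 1)"
proof -
  define a where "a = (\<lambda>y. \<chi> j. form_rep A \<alpha> d y (axis j 1))"
  define D where "D = frechet_derivative a (at (snd d q))"
  have "holo_on (snd d ` (W \<inter> fst d)) a" "snd d q \<in> snd d ` (W \<inter> fst d)"
    using assms by (auto simp: holomorphic_one_form_def a_def charts_at_def)
  note da = holo_on_has_derivative[OF this, folded D_def]
  define m where "m i j = D (axis i 1) $ j" for i j
  have D: "D u $ j = u $ 1 * m 1 j + u $ 2 * m 2 j + u $ 3 * m 3 j" for u j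
    by (subst complex_linear_expansion[OF has_derivative_linear[OF da(1)] da(2)]) (simp add: sum_3 m_def)
  \<comment> \<open>With \<open>m i j\<close> the i-th partial derivative of the j-th coefficient,
    this is the complex curl of the coefficient vector.\<close>
  define c :: "complex^3" where "c = vector [m 2 3 - m 3 2, m 3 1 - m 1 3, m 1 2 - m 2 1]"
  have c: "c $ 1 = m 2 3 - m 3 2" "c $ 2 = m 3 1 - m 1 3" "c $ 3 = m 1 2 - m 2 1"
    by (simp_all add: c_def)
  show ?thesis
    by (rule that[of c])
      (simp add: ext_deriv_form_rep[OF assms a_def, folded D_def] sum_3 D c algebra_simps)
qed

text \<open>Differentiating \<open>\<alpha> (DF u) = 0\<close> in the direction \<open>v\<close> and antisymmetrizing gives
  \<open>d\<alpha> (DF u, DF v) = 0\<close>, because the second derivative of \<open>F\<close> is symmetric.\<close>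

lemma legendrian_ext_deriv:
  fixes B :: "('m, real^'k) chart set"
  assumes X: "complex_manifold X A" and M: "smooth_manifold M B"
    and F: "smooth_map M B X A F" and leg: "legendrian M B A \<xi> F"
    and \<alpha>: "holomorphic_one_form A W \<alpha>" and W: "openin X W" "F p \<in> W"
    and \<xi>: "\<And>q. q \<in> W \<Longrightarrow> \<xi> q = {v \<in> tangent_space A q. \<alpha> q v = 0}"
    and b: "b \<in> charts_at B p" and d: "d \<in> charts_at A (F p)"
  shows "ext_deriv (form_rep A \<alpha> d) (snd d (F p)) (rep_deriv b F d p u) (rep_deriv b F d p v) = 0"
proof -
  note N = complex_imp_differentiable_manifold[OF X]
  note M' = smooth_imp_differentiable_manifold[OF M] and F' = smooth_imp_differentiable_map[OF F]
  have bd: "b \<in> B" "p \<in> fst b" "d \<in> A" "F p \<in> fst d" using b d by (auto simp: charts_at_def)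
  note bc = differentiable_manifold_chart[OF M' bd(1)] and dc = differentiable_manifold_chart[OF N bd(3)]
  have cont: "continuous_map M X F" using F by (simp add: smooth_map_def)
  define f where "f = local_rep b F d"
  define a where "a = (\<lambda>y. \<chi> j. form_rep A \<alpha> d y (axis j 1))"
  define a' where "a' = frechet_derivative a (at (snd d (F p)))"
  define D where "D z = frechet_derivative f (at z)" for z
  \<comment> \<open>The Legendrian condition is read on a whole neighbourhood of \<open>p\<close>,
    so that the vanishing of \<alpha> on the image of \<open>dF\<close> may be
    differentiated.\<close>
  define S where "S = snd b ` {q \<in> fst b. F q \<in> W \<inter> fst d}"
  have S: "open S" unfolding S_def
    using bc dc W(1) by (intro open_chart_image[OF bc] openin_continuous_map_preimage_gen[OF cont] openin_Int)
      (auto simp: chart_on_def)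
  have pS: "snd b p \<in> S" using bd W(2) by (auto simp: S_def)
  have "S \<subseteq> local_dom b F d" by (auto simp: S_def local_dom_def)
  moreover have "smooth_on (local_dom b F d) f" using F bd by (simp add: smooth_map_def f_def)
  ultimately have "smooth_on S f" using smooth_on_subset by blast
  then have C2: "Ck_on 2 f S" by (simp add: smooth_on_def)
  then have C2': "Ck_on (Suc (Suc 0)) f S" by (simp add: numeral_2_eq_2)
  have df: "(f has_derivative D z) (at z)" if "z \<in> S" for z
    unfolding D_def using Ck_on_has_derivative[OF C2' that] .
  define H where "H u = frechet_derivative (\<lambda>z. D z u) (at (snd b p))" for u
  have dD: "((\<lambda>z. D z u) has_derivative H u) (at (snd b p))" for u
    using Ck_on_has_derivative[of 0 "\<lambda>z. D z u" S] C2' pS unfolding H_def D_def by simp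
  have fp: "f (snd b p) = snd d (F p)" by (simp add: f_def local_rep_chart[OF bc bd(2)])
  have "holo_on (snd d ` (W \<inter> fst d)) a" "snd d (F p) \<in> snd d ` (W \<inter> fst d)"
    using \<alpha> bd W(2) by (auto simp: holomorphic_one_form_def a_def)
  note da = holo_on_has_derivative(1)[OF this, folded a'_def]
  have zero: "(\<Sum>j\<in>UNIV. a (f z) $ j * D z u $ j) = 0" if z: "z \<in> S" for z u
  proof -
    obtain q where q: "z = snd b q" "q \<in> fst b" "F q \<in> W" "F q \<in> fst d" using z unfolding S_def by blast
    have bd': "b \<in> charts_at B q" "d \<in> charts_at A (F q)" using q bd by (auto simp: charts_at_def)
    have "f z = snd d (F q)" by (simp add: f_def q(1) local_rep_chart[OF bc q(2)])
    then show ?thesis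
      using legendrian_form_rep[where p=q and \<alpha>=\<alpha>, OF X M' F' leg \<xi>[OF q(3)] bd', of u] form_rep_expansion[OF X \<alpha> bd'(2) q(3), of "D z u"]
      by (simp add: a_def D_def f_def q(1) mult.commute)
  qed
  \<comment> \<open>Leibniz rule: one term differentiates \<open>dF\<close>, giving the second
    derivative \<open>H\<close>, and the other differentiates the coefficients along
    \<open>F\<close>.\<close>
  have deriv: "(\<Sum>j\<in>UNIV. a (snd d (F p)) $ j * H u v $ j + a' (D (snd b p) v) $ j * D (snd b p) u $ j) = 0" for u v
  proof -
    have "((\<lambda>z. \<Sum>j\<in>UNIV. a (f z) $ j * D z u $ j) has_derivative
      (\<lambda>v. \<Sum>j\<in>UNIV. a (f (snd b p)) $ j * H u v $ j + a' (D (snd b p) v) $ j * D (snd b p) u $ j)) (at (snd b p))"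
      by (intro has_derivative_sum has_derivative_mult bounded_linear.has_derivative[OF bounded_linear_vec_nth]
          dD has_derivative_compose[OF df[OF pS]]) (simp add: fp da)
    moreover have "((\<lambda>z. \<Sum>j\<in>UNIV. a (f z) $ j * D z u $ j) has_derivative (\<lambda>v. 0)) (at (snd b p))"
      by (rule has_derivative_transform_within_open[OF has_derivative_const S pS]) (simp add: zero)
    ultimately show ?thesis using fun_cong[OF has_derivative_unique, of _ _ _ _ v] unfolding fp by blast
  qed
  have sym: "H u v = H v u" for u v
    unfolding H_def D_def using second_derivative_symmetric[OF S pS C2] .
  \<comment> \<open>By symmetry of \<open>H\<close>, the term \<open>?s\<close> is the same for both
    orders of \<open>u\<close> and \<open>v\<close>; subtraction leaves exactly the two sums whose
    difference is \<open>ext_deriv\<close>.\<close>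
  let ?s = "\<Sum>j\<in>UNIV. a (snd d (F p)) $ j * H u v $ j"
  have "?s + (\<Sum>j\<in>UNIV. a' (D (snd b p) v) $ j * D (snd b p) u $ j) = 0"
    using deriv[of u v] by (simp only: sum.distrib)
  moreover have "?s + (\<Sum>j\<in>UNIV. a' (D (snd b p) u) $ j * D (snd b p) v $ j) = 0"
    using deriv[of v u] by (simp only: sum.distrib sym[of v u])
  ultimately have "(\<Sum>j\<in>UNIV. a' (D (snd b p) v) $ j * D (snd b p) u $ j)
      = (\<Sum>j\<in>UNIV. a' (D (snd b p) u) $ j * D (snd b p) v $ j)"
    by (simp only: add_eq_0_iff)
  then show ?thesis
    unfolding ext_deriv_form_rep[OF X \<alpha> W(1) d W(2) a_def, folded a'_def] D_def f_def by simp
qed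

text \<open>Vanishing of all 2 by 2 minors expresses complex linear dependence without naming a
  factor; where one entry is known to be nonzero, division by it recovers the factor.\<close>

lemma legendrian_minors:
  fixes B :: "('m, real^'k) chart set"
  assumes X: "complex_contact_manifold X A \<xi>" and M: "smooth_manifold M B"
    and F: "smooth_map M B X A F" and leg: "legendrian M B A \<xi> F"
    and b: "b \<in> charts_at B p" and d: "d \<in> charts_at A (F p)"
  shows "rep_deriv b F d p u $ i * rep_deriv b F d p v $ j = rep_deriv b F d p u $ j * rep_deriv b F d p v $ i"
proof -
  have X': "complex_manifold X A" using X by (simp add: complex_contact_manifold_def)
  note N = complex_imp_differentiable_manifold[OF X']
  obtain W \<alpha> where W: "openin X W" "F p \<in> W" and con: "holomorphic_contact_form A W \<alpha>"
    and \<xi>: "\<And>q. q \<in> W \<Longrightarrow> \<xi> q = {v \<in> tangent_space A q. \<alpha> q v = 0}"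
    using X charts_atD(5)[OF N d] unfolding complex_contact_manifold_def by blast
  have \<alpha>: "holomorphic_one_form A W \<alpha>" using con by (simp add: holomorphic_contact_form_def)
  have "d \<in> A" "snd d (F p) \<in> snd d ` (W \<inter> fst d)" using d W(2) by (auto simp: charts_at_def)
  then obtain x y z where nz: "wedge_1_2 (form_rep A \<alpha> d (snd d (F p)))
      (ext_deriv (form_rep A \<alpha> d) (snd d (F p))) x y z \<noteq> 0"
    using con unfolding holomorphic_contact_form_def by blast
  obtain c :: "complex^3" where c: "\<And>u v. ext_deriv (form_rep A \<alpha> d) (snd d (F p)) u v
    = c $ 1 * (u $ 2 * v $ 3 - u $ 3 * v $ 2)
      + c $ 2 * (u $ 3 * v $ 1 - u $ 1 * v $ 3) + c $ 3 * (u $ 1 * v $ 2 - u $ 2 * v $ 1)"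
    using ext_deriv_form_rep_cross[OF X' \<alpha> W(1) d W(2)] by blast
  note leg' = legendrian_form_rep[where p=p and \<alpha>=\<alpha>, OF X' smooth_imp_differentiable_manifold[OF M]
      smooth_imp_differentiable_map[OF F] leg \<xi>[OF W(2)] b d]
  show ?thesis
  proof (rule wedge_kernel_minors[OF _ c nz leg' leg'])
    show "form_rep A \<alpha> d (snd d (F p)) u = (\<chi> j. form_rep A \<alpha> d (snd d (F p)) (axis j 1)) $ 1 * u $ 1
      + (\<chi> j. form_rep A \<alpha> d (snd d (F p)) (axis j 1)) $ 2 * u $ 2
      + (\<chi> j. form_rep A \<alpha> d (snd d (F p)) (axis j 1)) $ 3 * u $ 3" for u
      using form_rep_expansion[OF X' \<alpha> d W(2), of u] by (simp add: sum_3 mult.commute)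
    show "ext_deriv (form_rep A \<alpha> d) (snd d (F p)) (rep_deriv b F d p u) (rep_deriv b F d p v) = 0"
      using legendrian_ext_deriv[OF X' M F leg \<alpha> W \<xi> b d] .
  qed
qed

section \<open>The complex structure\<close>

text \<open>The charts of the complex structure are the components of \<open>F\<close> in the charts of the target,
  restricted to the open sets on which they are local diffeomorphisms.\<close>

definition component_charts ::
  "'m topology \<Rightarrow> ('m, real^'k) chart set \<Rightarrow> ('x, complex^'n) chart set \<Rightarrow> ('m \<Rightarrow> 'x) \<Rightarrow>
    ('m, complex^1) chart set" where
  "component_charts M B A F = {c. chart_on M c \<and>
     (\<exists>d\<in>A. \<exists>j. F ` fst c \<subseteq> fst d \<and> snd c = (\<lambda>p. \<chi> _. snd d (F p) $ j) \<and>
        (\<forall>p\<in>fst c. \<forall>b\<in>charts_at B p. \<forall>u. rep_deriv b F d p u $ j = 0 \<longrightarrow> u = 0))}"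

lemma component_chartsE:
  assumes "c \<in> component_charts M B A F"
  obtains d j where "chart_on M c" "d \<in> A" "F ` fst c \<subseteq> fst d" "\<And>p. snd c p = (\<chi> _. snd d (F p) $ j)"
    "\<And>p b u. p \<in> fst c \<Longrightarrow> b \<in> charts_at B p \<Longrightarrow> rep_deriv b F d p u $ j = 0 \<Longrightarrow> u = 0"
  using assms unfolding component_charts_def by auto

lemma component_charts_coord:
  assumes "c \<in> component_charts M B A F"
  obtains d j where "d \<in> A" "F ` fst c \<subseteq> fst d" "\<And>p. snd c p = (\<chi> _. snd d (F p) $ j)"
  using assms unfolding component_charts_def by auto

section \<open>Component charts against the charts of \<open>M\<close> and of the target\<close>

lemma bounded_linear_component: "bounded_linear (\<lambda>y :: complex^'n. (\<chi> _. y $ j) :: complex^1)"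
  by (rule bounded_linear_compose[of "\<lambda>w. \<chi> _. w", OF _ bounded_linear_vec_nth])
    (auto intro!: bounded_linear_intro[where K=1] simp: vec_eq_iff norm_vec_def L2_set_def)

lemma coord_change_component:
  assumes "chart_on M b" "\<And>p. snd c p = (\<chi> _. snd d (F p) $ j)"
    and "z \<in> snd b ` fst b"
  shows "coord_change b c z = (\<chi> _. local_rep b F d z $ j)"
  using assms by (auto simp: local_rep_def)

text \<open>Read in the chart \<open>c\<close>, the j-th component of \<open>F\<close> is the
  coordinate itself. This normalizes the derivative of \<open>F\<close> in that chart and makes it
  injective.\<close>

lemma component_derivative:
  fixes c :: "('m, complex^1) chart"
  assumes c: "chart_on M c" "p \<in> fst c" and j: "\<And>p. snd c p = (\<chi> _. snd d (F p) $ j)"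
    and D: "(local_rep c F d has_derivative D) (at (snd c p))"
  shows "(\<chi> _. D w $ j) = w"
proof -
  have "((\<lambda>z. (\<chi> _. local_rep c F d z $ j) :: complex^1) has_derivative (\<lambda>w. w)) (at (snd c p))"
  proof (rule has_derivative_transform_within_open[OF has_derivative_ident])
    show "open (snd c ` fst c)" "snd c p \<in> snd c ` fst c" using c by (auto simp: chart_on_def)
    fix z assume "z \<in> snd c ` fst c"
    then obtain q where q: "z = snd c q" "q \<in> fst c" by blast
    show "z = (\<chi> _. local_rep c F d z $ j)"
      unfolding q(1) local_rep_chart[OF c(1) q(2)] by (rule j)
  qed
  from has_derivative_unique[OF bounded_linear.has_derivative[OF bounded_linear_component[where j=j] D] this]
  show ?thesis by (rule fun_cong)
qed

text \<open>Towards \<open>c\<close>, the coordinate change is a linear image of a representative of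
  \<open>F\<close>. Backwards it is a continuous inverse of this map, smooth because the
  nonvanishing condition on \<open>c\<close> makes the derivative injective.\<close>

lemma
  fixes B :: "('m, real^2) chart set"
  assumes M: "smooth_manifold M B" and N: "differentiable_manifold X A" and F: "smooth_map M B X A F"
    and c: "c \<in> component_charts M B A F" and b: "b \<in> B"
  shows smooth_to_component_chart: "smooth_on (coord_dom b c) (coord_change b c)"
    and smooth_from_component_chart: "smooth_on (coord_dom c b) (coord_change c b)"
proof -
  obtain d j where cc: "chart_on M c" and d: "d \<in> A" "F ` fst c \<subseteq> fst d"
    and j: "\<And>p. snd c p = (\<chi> _. snd d (F p) $ j)"
    and nz: "\<And>p b u. p \<in> fst c \<Longrightarrow> b \<in> charts_at B p \<Longrightarrow> rep_deriv b F d p u $ j = 0 \<Longrightarrow> u = 0"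
    using component_chartsE[OF c] by blast
  note bc = differentiable_manifold_chart[OF smooth_imp_differentiable_manifold[OF M] b]
  have id: "continuous_map M M (\<lambda>p. p)" by simp
  note S = open_local_dom[OF bc cc id] and T = open_local_dom[OF cc bc id]
  have sub: "coord_dom b c \<subseteq> local_dom b F d" using d(2) by (auto simp: local_dom_def)
  have f: "smooth_on (coord_dom b c) (local_rep b F d)"
    using F b d(1) smooth_on_subset[OF _ sub] unfolding smooth_map_def by blast
  have eq: "(\<chi> _. local_rep b F d z $ j) = coord_change b c z" if "z \<in> coord_dom b c" for z
    using coord_change_component[OF bc j, of z] that by (auto simp: local_dom_def)
  show sm: "smooth_on (coord_dom b c) (coord_change b c)"
  proof (rule smooth_on_cong[OF S])
    show "smooth_on (coord_dom b c) (\<lambda>z. (\<chi> _. local_rep b F d z $ j) :: complex^1)"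
      using smooth_on_bounded_linear[OF S bounded_linear_component[where j=j] f] .
  qed (rule eq)
  show "smooth_on (coord_dom c b) (coord_change c b)"
  proof (rule smooth_on_inverse_map_dim[OF _ S T sm])
    show "DIM(complex^1) = CARD(2)" by simp
    show "inj (frechet_derivative (coord_change b c) (at z))" if z: "z \<in> coord_dom b c" for z
    proof -
      obtain p where p: "p \<in> fst b" "p \<in> fst c" "z = snd b p" using z by (rule local_domE)
      have "((\<lambda>z. (\<chi> _. local_rep b F d z $ j) :: complex^1) has_derivative (\<lambda>u. \<chi> _. rep_deriv b F d p u $ j)) (at z)"
        using bounded_linear.has_derivative[OF bounded_linear_component[where j=j] smooth_on_has_derivative[OF f z]]
        unfolding p(3) .
      then have "(coord_change b c has_derivative (\<lambda>u. \<chi> _. rep_deriv b F d p u $ j)) (at z)"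
        by (rule has_derivative_transform_within_open[OF _ S z eq])
      note der = frechet_derivative_at[OF this, symmetric] and lin = has_derivative_linear[OF this]
      have "u = 0" if "(\<chi> _. rep_deriv b F d p u $ j) = (0 :: complex^1)" for u
        using nz[OF p(2), of b u] p(1) b that by (simp add: charts_at_def vec_eq_iff)
      then show ?thesis unfolding der linear_injective_0[OF lin] by blast
    qed
    show "continuous_on (coord_dom c b) (coord_change c b)"
      using continuous_on_local_rep[OF cc bc id] .
    show "coord_change c b ` coord_dom c b \<subseteq> coord_dom b c"
      by (auto elim!: local_domE simp: local_rep_chart[OF cc] intro: local_domI)
    show "coord_change b c (coord_change c b y) = y" if "y \<in> coord_dom c b" for y
      using that by (auto elim!: local_domE simp: local_rep_chart[OF cc] local_rep_chart[OF bc])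
  qed
qed

text \<open>The image of the differential is a complex line, which the \<open>j\<close>-th coordinate maps
  isomorphically onto \<open>\<complex>\<close>.\<close>

lemma component_chart_has_derivative:
  fixes B :: "('m, real^2) chart set"
  assumes X: "complex_contact_manifold X A \<xi>" and M: "smooth_manifold M B"
    and F: "smooth_map M B X A F" and leg: "legendrian M B A \<xi> F"
    and c: "c \<in> charts_at (component_charts M B A F) p" and d': "d' \<in> charts_at A (F p)"
  obtains E where "(local_rep c F d' has_derivative (\<lambda>w. w $ 1 *s E)) (at (snd c p))"
proof -
  have X': "complex_manifold X A" using X by (simp add: complex_contact_manifold_def)
  note N = complex_imp_differentiable_manifold[OF X']
  note M' = smooth_imp_differentiable_manifold[OF M] and F' = smooth_imp_differentiable_map[OF F]
  have cC: "c \<in> component_charts M B A F" "p \<in> fst c" using c by (simp_all add: charts_at_def)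
  obtain d j where cc: "chart_on M c" and d0: "d \<in> A" "F ` fst c \<subseteq> fst d"
    and j: "\<And>p. snd c p = (\<chi> _. snd d (F p) $ j)"
    and nz: "\<And>p b u. p \<in> fst c \<Longrightarrow> b \<in> charts_at B p \<Longrightarrow> rep_deriv b F d p u $ j = 0 \<Longrightarrow> u = 0"
    using component_chartsE[OF cC(1)] by blast
  have d: "d \<in> charts_at A (F p)" using d0 cC(2) by (auto simp: charts_at_def)
  have "p \<in> topspace M" using fst_chart_subset[OF cc] cC(2) by blast
  then obtain b where b: "b \<in> charts_at B p" using charts_at_nonempty[OF M'] by blast
  note bA = charts_atD[OF M' b]
  have id: "continuous_map M M (\<lambda>p. p)" "differentiable_map X A X A (\<lambda>p. p)"
    using N by (simp_all add: differentiable_manifold_def)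
  \<comment> \<open>\<open>Q\<close> passes from the complex chart to the real one, \<open>D\<close>
    is \<open>dF\<close> in real coordinates, and \<open>K\<close> passes from the target chart
    \<open>d\<close> that defines \<open>c\<close> to the arbitrary \<open>d'\<close>. Only
    \<open>K\<close> is known to be complex linear at this point.\<close>
  define D where "D = rep_deriv b F d p"
  define K where "K = rep_deriv d (\<lambda>p. p) d' (F p)"
  define Q where "Q = rep_deriv c (\<lambda>p. p) b p"
  have K: "K (a *s v) = a *s K v" for a v
    unfolding K_def using rep_deriv_complex_linear(2)[OF X' d d'] .
  have Q: "(coord_change c b has_derivative Q) (at (snd c p))"
    unfolding Q_def using smooth_from_component_chart[OF M N F cC(1) bA(1)] local_domI[OF cC(2), of "\<lambda>p. p" b] bA(2)
    by (intro smooth_on_has_derivative) auto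
  have DQ: "D (Q w) $ j = w $ 1" for w
  proof -
    have "(local_rep c F d has_derivative (\<lambda>w. D (Q w))) (at (snd c p))"
      using local_rep_has_derivative_compose[OF cc bA(3) id(1) cC(2) bA(2) Q] rep_has_derivative[OF F' b d]
      by (simp add: D_def)
    from component_derivative[OF cc cC(2) j this, of w]
    have "((\<chi> _. D (Q w) $ j) :: complex^1) $ 1 = w $ 1" by metis
    then show ?thesis by simp
  qed
  \<comment> \<open>Any nonzero real vector would do: its image \<open>D e\<close> has nonzero j-th
    entry and spans the complex line. The minors with index \<open>j\<close> then express every
    \<open>D u\<close> through its j-th entry.\<close>
  define e :: "real^2" where "e = axis 1 1"
  have e: "D e $ j \<noteq> 0" using nz[OF cC(2) b, of e] by (auto simp: D_def e_def axis_eq_0_iff)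
  have "D u = (D u $ j / D e $ j) *s D e" for u
    using legendrian_minors[OF X M F leg b d, of u _ e j] e by (simp add: D_def vec_eq_iff field_simps)
  then have "K (D (Q w)) = w $ 1 *s ((1 / D e $ j) *s K (D e))" for w
    by (metis DQ K divide_inverse mult_1 vector_smult_assoc)
  moreover have "(local_rep c F d' has_derivative (\<lambda>w. K (D (Q w)))) (at (snd c p))"
  proof -
    have "rep_deriv b F d' p = (\<lambda>u. K (D u))"
      unfolding K_def D_def using rep_deriv_compose[OF M' N F' id(2) b d, of d'] d' by (intro ext) simp
    from local_rep_has_derivative_compose[OF cc bA(3) id(1) cC(2) bA(2) Q rep_has_derivative[OF F' b d'], unfolded this]
    show ?thesis .
  qed
  ultimately have "(local_rep c F d' has_derivative (\<lambda>w. w $ 1 *s ((1 / D e $ j) *s K (D e)))) (at (snd c p))"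
    by (simp only:)
  then show ?thesis by (rule that)
qed

text \<open>An index \<open>j\<close> with a nonzero entry on one tangent vector suffices: the
  hyperplane where the j-th coordinate vanishes meets the complex line \<open>dF(TM)\<close> only in
  0. So the j-th component has injective real derivative at \<open>p\<close>, and the inverse
  function theorem applies.\<close>

lemma component_chart_exists:
  fixes B :: "('m, real^2) chart set"
  assumes X: "complex_contact_manifold X A \<xi>" and M: "smooth_manifold M B"
    and F: "smooth_map M B X A F" and im: "immersion M B X A F" and leg: "legendrian M B A \<xi> F"
    and p: "p \<in> topspace M"
  shows "\<exists>c. c \<in> charts_at (component_charts M B A F) p"
proof -
  have X': "complex_manifold X A" using X by (simp add: complex_contact_manifold_def)
  note N = complex_imp_differentiable_manifold[OF X']
  note M' = smooth_imp_differentiable_manifold[OF M] and F' = smooth_imp_differentiable_map[OF F]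
  have cont: "continuous_map M X F" using F by (simp add: smooth_map_def)
  obtain b where b: "b \<in> charts_at B p" using charts_at_nonempty[OF M' p] by blast
  have "F p \<in> topspace X" using cont p continuous_map_image_subset_topspace by blast
  then obtain d where d: "d \<in> charts_at A (F p)" using charts_at_nonempty[OF N] by blast
  note bA = charts_atD[OF M' b] and dA = charts_atD[OF N d]
  define e :: "real^2" where "e = axis 1 1"
  have lin: "linear (rep_deriv b F d q)" if "q \<in> fst b" "F q \<in> fst d" for q
    using that bA(1) dA(1)
    by (intro has_derivative_linear[OF rep_has_derivative[OF F']]) (simp_all add: charts_at_def)
  note inj = immersion_inj_rep_deriv[OF M' N F' im b d]
  then have inj0: "u = 0" if "rep_deriv b F d p u = 0" for u
    using that linear_injective_0[OF lin[OF bA(2) dA(2)]] by blast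
  have "rep_deriv b F d p e \<noteq> 0" using inj0[of e] by (auto simp: e_def axis_eq_0_iff)
  then obtain j where j: "rep_deriv b F d p e $ j \<noteq> 0" by (auto simp: vec_eq_iff)
  have inj_j: "u = 0" if "rep_deriv b F d p u $ j = 0" for u
  proof (rule inj0)
    show "rep_deriv b F d p u = 0"
      using legendrian_minors[OF X M F leg b d, of u _ e j] that j by (simp add: vec_eq_iff)
  qed
  define f where "f = (\<lambda>z. (\<chi> _. local_rep b F d z $ j) :: complex^1)"
  note S = open_local_dom[OF bA(3) dA(3) cont]
  have F_rep: "smooth_on (local_dom b F d) (local_rep b F d)"
    using F bA(1) dA(1) by (simp add: smooth_map_def)
  have f: "smooth_on (local_dom b F d) f"
    unfolding f_def using smooth_on_bounded_linear[OF S bounded_linear_component[where j=j] F_rep] .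
  have f': "frechet_derivative f (at (snd b q)) = (\<lambda>u. \<chi> _. rep_deriv b F d q u $ j)"
    if "q \<in> fst b" "F q \<in> fst d" for q
    unfolding f_def using local_domI[where F=F, OF that]
    by (intro frechet_derivative_at[symmetric] bounded_linear.has_derivative[OF bounded_linear_component]
        smooth_on_has_derivative[OF F_rep])
  have lin': "linear (frechet_derivative f (at (snd b q)))" if "q \<in> fst b" "F q \<in> fst d" for q
    using has_derivative_linear[OF smooth_on_has_derivative[OF f local_domI[where F=F, OF that]]] .
  have "inj (frechet_derivative f (at (snd b p)))"
  proof (subst linear_injective_0[OF lin'[OF bA(2) dA(2)]], intro allI impI)
    fix u assume "frechet_derivative f (at (snd b p)) u = 0"
    then have "rep_deriv b F d p u $ j = 0" unfolding f'[OF bA(2) dA(2)] by (simp add: vec_eq_iff)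
    then show "u = 0" by (rule inj_j)
  qed
  then obtain U where U: "open U" "snd b p \<in> U" "U \<subseteq> local_dom b F d" "inj_on f U"
    and opn: "\<And>V. open V \<Longrightarrow> V \<subseteq> U \<Longrightarrow> open (f ` V)"
    and injU: "\<And>x. x \<in> U \<Longrightarrow> inj (frechet_derivative f (at x))"
    using smooth_on_local_inverse[OF _ S f local_domI[where F=F, OF bA(2) dA(2)]] by auto
  \<comment> \<open>The domain is pulled back from \<open>U\<close> through the real chart;
    \<open>U\<close> lies in \<open>local_dom b F d\<close>, so \<open>F\<close> maps
    \<open>W\<close> into the domain of \<open>d\<close>.\<close>
  define W where "W = {q \<in> fst b. snd b q \<in> U}"
  have Wb: "W \<subseteq> fst b" by (auto simp: W_def)
  have "openin (subtopology M (fst b)) {q \<in> topspace (subtopology M (fst b)). snd b q \<in> U}"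
    using continuous_map_chart[OF bA(3)] U(1) by (intro openin_continuous_map_preimage) auto
  moreover have "{q \<in> topspace (subtopology M (fst b)). snd b q \<in> U} = W"
    using fst_chart_subset[OF bA(3)] by (auto simp: W_def)
  ultimately have W: "openin M W"
    using bA(3) openin_trans_full by (auto simp: chart_on_def)
  have WF: "F q \<in> fst d" if "q \<in> W" for q
  proof -
    have "snd b q \<in> local_dom b F d" using that U(3) by (auto simp: W_def)
    then obtain r where r: "r \<in> fst b" "F r \<in> fst d" "snd b q = snd b r" by (rule local_domE)
    then have "q = r" using inj_on_chart[OF bA(3)] that unfolding W_def inj_on_def by blast
    then show ?thesis using r by simp
  qed
  define \<phi> where "\<phi> = (\<lambda>q. (\<chi> _. snd d (F q) $ j) :: complex^1)"
  have \<phi>: "\<phi> q = f (snd b q)" if "q \<in> W" for q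
    using that by (simp add: \<phi>_def f_def W_def local_rep_chart[OF bA(3)])
  have opnW: "open (\<phi> ` O')" if "openin M O'" "O' \<subseteq> W" for O'
  proof -
    have "\<phi> ` O' = f ` (snd b ` O')" using \<phi> that(2) by (auto simp: image_image intro!: image_cong)
    also have "open \<dots>"
      using that Wb by (intro opn open_chart_image[OF bA(3)]) (auto simp: W_def)
    finally show ?thesis .
  qed
  have "chart_on M (W, \<phi>)"
    unfolding chart_on_def fst_conv snd_conv
  proof (intro conjI W opnW order_refl bijective_open_imp_homeomorphic_map)
    have tsW: "topspace (subtopology M W) = W" using openin_subset[OF W] by auto
    have "continuous_map (subtopology M W) euclidean (\<lambda>q. f (snd b q))"
    proof -
      have "continuous_map (subtopology M W) euclidean (snd b)"
        using continuous_map_from_subtopology_mono[OF continuous_map_chart[OF bA(3)] Wb] .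
      then have "continuous_map (subtopology M W) (top_of_set U) (snd b)"
        by (rule continuous_map_into_subtopology) (auto simp: W_def)
      moreover have "continuous_on U f"
        using f[unfolded smooth_on_def, rule_format, of 0] U(3) continuous_on_subset by auto
      ultimately show ?thesis
        using continuous_map_compose[of "subtopology M W" "top_of_set U" "snd b" euclidean f]
        by (simp add: comp_def)
    qed
    then have "continuous_map (subtopology M W) euclidean \<phi>"
      by (rule continuous_map_eq) (simp add: \<phi> tsW del: topspace_subtopology)
    then show "continuous_map (subtopology M W) (top_of_set (\<phi> ` W)) \<phi>"
      by (rule continuous_map_into_subtopology) (auto simp: tsW simp del: topspace_subtopology)
    show "open_map (subtopology M W) (top_of_set (\<phi> ` W)) \<phi>"
      unfolding open_map_def openin_open_subtopology[OF W] openin_open_eq[OF opnW[OF W order_refl]]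
      using opnW by blast
    show "\<phi> ` topspace (subtopology M W) = topspace (top_of_set (\<phi> ` W))"
      by (simp add: tsW del: topspace_subtopology)
    have "inj_on (\<lambda>q. f (snd b q)) W"
      using U(4) inj_on_chart[OF bA(3)] unfolding W_def inj_on_def by blast
    then show "inj_on \<phi> (topspace (subtopology M W))"
      unfolding tsW by (simp add: inj_on_def \<phi>)
  qed
  \<comment> \<open>The condition concerns every real chart \<open>b'\<close> at every point of
    \<open>W\<close>. It is known in \<open>b\<close>, and coordinate changes between
    \<open>b'\<close> and \<open>b\<close> are invertible.\<close>
  moreover have "u = 0" if q: "q \<in> W" and b': "b' \<in> charts_at B q" and u: "rep_deriv b' F d q u $ j = 0" for q b' u
  proof -
    have qb: "q \<in> fst b" "snd b q \<in> U" and qd: "F q \<in> fst d" using q WF by (auto simp: W_def)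
    then have b: "b \<in> charts_at B q" and d: "d \<in> charts_at A (F q)"
      using bA dA by (auto simp: charts_at_def)
    have id: "differentiable_map M B M B (\<lambda>p. p)" using M' by (simp add: differentiable_manifold_def)
    define w where "w = rep_deriv b' (\<lambda>p. p) b q u"
    have "rep_deriv b F d q w $ j = 0"
      using u rep_deriv_compose[OF M' M' id F' b' b d, of u] by (simp add: w_def)
    then have "frechet_derivative f (at (snd b q)) w = 0"
      by (simp add: f'[OF qb(1) qd] vec_eq_iff)
    then have "w = 0"
      using injU[OF qb(2)] unfolding linear_injective_0[OF lin'[OF qb(1) qd]] by blast
    moreover have "rep_deriv b (\<lambda>p. p) b' q w = u"
      using rep_deriv_compose[OF M' M' id id b' b b', of u] rep_deriv_coord_change_self[OF M' b']
      by (simp add: w_def)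
    moreover have "rep_deriv b (\<lambda>p. p) b' q 0 = 0"
      using linear_0[OF has_derivative_linear[OF rep_has_derivative[OF id b b']]] .
    ultimately show "u = 0" by simp
  qed
  ultimately have "(W, \<phi>) \<in> component_charts M B A F"
    unfolding component_charts_def using dA(1) WF
    by (auto simp: \<phi>_def intro!: bexI[of _ d] exI[of _ j])
  moreover have "p \<in> W" using bA(2) U(2) by (simp add: W_def)
  ultimately show ?thesis by (auto simp: charts_at_def)
qed

text \<open>One atlas serves both claims: \<open>M\<close> with the component charts is the Riemann
  surface, and \<open>F\<close> itself is the holomorphic immersion whose image is the
  curve.\<close>

theorem proposition1p5:
  fixes X :: "'x topology" and A :: "('x, complex^3) chart set"
    and \<xi> :: "'x \<Rightarrow> ('x, complex^3) tvec set"
    and M :: "'m topology" and B :: "('m, real^2) chart set"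
    and F :: "'m \<Rightarrow> 'x"
  assumes "complex_contact_manifold X A \<xi>"
    and "smooth_manifold M B"
    and "smooth_map M B X A F"
    and "immersion M B X A F"
    and "legendrian M B A \<xi> F"
  shows "immersed_complex_curve TYPE('m) X A (F ` topspace M) \<and>
    (\<exists>C. riemann_surface_structure M B C \<and> holomorphic_map M C X A F)"
proof -
  have X: "complex_manifold X A" using assms(1) by (simp add: complex_contact_manifold_def)
  note N = complex_imp_differentiable_manifold[OF X]
  have cont: "continuous_map M X F" using assms(3) by (simp add: smooth_map_def)
  define C where "C = component_charts M B A F"
  have chart: "chart_on M c" if "c \<in> C" for c using that by (simp add: C_def component_charts_def)
  have der: "\<exists>E. (local_rep c F d has_derivative (\<lambda>w. w $ 1 *s E)) (at (snd c p))"
    if "c \<in> C" "d \<in> A" "p \<in> fst c" "F p \<in> fst d" for c d p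
    using component_chart_has_derivative[OF assms(1,2,3,5), of c p d] that
    by (auto simp: C_def charts_at_def)
  have "topological_atlas M C"
    unfolding topological_atlas_def
  proof (intro conjI ballI chart)
    show "Hausdorff_space M" "second_countable M"
      using assms(2) by (simp_all add: smooth_manifold_def topological_atlas_def)
    show "(\<Union>c\<in>C. fst c) = topspace M"
    proof
      show "(\<Union>c\<in>C. fst c) \<subseteq> topspace M" using fst_chart_subset[OF chart] by blast
      show "topspace M \<subseteq> (\<Union>c\<in>C. fst c)"
        using component_chart_exists[OF assms] by (fastforce simp: C_def charts_at_def)
    qed
  qed
  \<comment> \<open>The coordinate change is a component of \<open>F\<close> in the target chart
    that defines \<open>c'\<close>; in the chart \<open>c\<close> the derivative of \<open>F\<close>
    is multiplication of a fixed vector by the complex coordinate.\<close>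
  moreover have "holo_on (coord_dom c c') (coord_change c c')" if c: "c \<in> C" "c' \<in> C" for c c'
    unfolding holo_on_def
  proof
    fix z assume z: "z \<in> coord_dom c c'"
    obtain d j where d: "d \<in> A" "F ` fst c' \<subseteq> fst d" and j: "\<And>p. snd c' p = (\<chi> _. snd d (F p) $ j)"
      using component_charts_coord[OF c(2)[unfolded C_def], of thesis] that by (simp only:)
    obtain p where p: "p \<in> fst c" "p \<in> fst c'" "z = snd c p" using z by (rule local_domE)
    obtain E where "(local_rep c F d has_derivative (\<lambda>w. w $ 1 *s E)) (at z)"
      using der[OF c(1) d(1) p(1)] d(2) p(2,3) by blast
    then have "((\<lambda>z. (\<chi> _. local_rep c F d z $ j) :: complex^1) has_derivative (\<lambda>w. \<chi> _. (w $ 1 *s E) $ j)) (at z)"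
      by (rule bounded_linear.has_derivative[OF bounded_linear_component])
    then have "(coord_change c c' has_derivative (\<lambda>w. \<chi> _. (w $ 1 *s E) $ j)) (at z)"
    proof (rule has_derivative_transform_within_open[OF _ open_local_dom z])
      show "(\<chi> _. local_rep c F d y $ j) = coord_change c c' y" if "y \<in> coord_dom c c'" for y
        using coord_change_component[OF chart[OF c(1)] j, of y] that by (auto simp: local_dom_def)
    qed (rule chart c continuous_map_id[unfolded id_def])+
    then show "\<exists>D. (coord_change c c' has_derivative D) (at z) \<and> (\<forall>a v. D (a *s v) = a *s D v)"
      by (intro exI conjI) (auto simp: vec_eq_iff)
  qed
  ultimately have C: "complex_manifold M C" by (simp add: complex_manifold_def)
  have str: "riemann_surface_structure M B C"
    using C smooth_to_component_chart[OF assms(2) N assms(3)] smooth_from_component_chart[OF assms(2) N assms(3)]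
    by (simp add: riemann_surface_structure_def riemann_surface_def C_def)
  have holo: "holomorphic_map M C X A F"
    unfolding holomorphic_map_def holo_on_def
  proof (intro conjI cont ballI)
    fix c d z assume c: "c \<in> C" "d \<in> A" and z: "z \<in> local_dom c F d"
    obtain p where p: "p \<in> fst c" "F p \<in> fst d" "z = snd c p" using z by (rule local_domE)
    then obtain E where "(local_rep c F d has_derivative (\<lambda>w. w $ 1 *s E)) (at z)"
      using der[OF c] by blast
    then show "\<exists>D. (local_rep c F d has_derivative D) (at z) \<and> (\<forall>a v. D (a *s v) = a *s D v)"
      by (intro exI conjI) (auto simp: vec_eq_iff)
  qed
  have "immersion M C X A F"
    unfolding immersion_def
  proof (intro ballI inj_onI)
    fix p v w assume p: "p \<in> topspace M" and v: "v \<in> tangent_space C p" and w: "w \<in> tangent_space C p"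
      and eq: "differential C A F p v = differential C A F p w"
    note C' = complex_imp_differentiable_manifold[OF C]
    note F' = holomorphic_imp_differentiable_map[OF holo]
    obtain c where c: "c \<in> charts_at C p" using charts_at_nonempty[OF C' p] by blast
    note cA = charts_atD[OF C' c]
    obtain d j where d: "d \<in> A" "F ` fst c \<subseteq> fst d" and j: "\<And>p. snd c p = (\<chi> _. snd d (F p) $ j)"
      using component_charts_coord[OF cA(1)[unfolded C_def], of thesis] that by (simp only:)
    have d': "d \<in> charts_at A (F p)" using d cA(2) by (auto simp: charts_at_def)
    define D where "D = rep_deriv c F d p"
    have "coord_tvec A d (F p) (D (v c)) = coord_tvec A d (F p) (D (w c))"
      using differential_coord_tvec[OF C' N F' c d', of "v c"] differential_coord_tvec[OF C' N F' c d', of "w c"] eq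
      unfolding tangent_space_eq_coord_tvec[OF C' c v] tangent_space_eq_coord_tvec[OF C' c w] D_def by simp
    then have Dvw: "D (v c) = D (w c)" using coord_tvec_chart[OF N d'] by metis
    \<comment> \<open>One component of \<open>dF\<close> is the identity in the chart
      \<open>c\<close>, so \<open>dF\<close> is injective; the immersion property over the real
      atlas need not be carried over.\<close>
    have "(\<chi> _. D u $ j) = u" for u
      using component_derivative[OF cA(3,2) j rep_has_derivative[OF F' c d']] unfolding D_def .
    then have "v c = w c" using Dvw by metis
    then show "v = w"
      using tangent_space_eq_coord_tvec[OF C' c v] tangent_space_eq_coord_tvec[OF C' c w] by metis
  qed
  then have "immersed_complex_curve TYPE('m) X A (F ` topspace M)"
    unfolding immersed_complex_curve_def using C holo by (auto simp: riemann_surface_def)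
  then show ?thesis using str holo by blast
qed

end
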